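(* Let $n,r\in \mathbb{N}$ with $n \ge 3$ and $r\ge 4$. Then, for each $k\in \mathbb{N}_0$, \[\mathsf{SD}_k(C_n^r)\ge \mathsf{SD}_{k+r-1}(C_n) + (r-1)(n-1).\] In particular, \[\mathsf{SD}_k(C_n^r) \ge \mathsf{D}^{\ast}(C_n^r) - \max \left\{0,\; n - k-r+1 - \left\lfloor \frac{-1 + \sqrt{1 + 8\max\{n-k-r+1,0\}}}{2} \right\rfloor \right\}.\] Moreover, if $\mathsf{D}(C_n^r) = \mathsf{D}^{\ast}(C_n^r)$, in particular if $n$ is a prime power, then, for $r \ge n-k$, \[\mathsf{SD}_k(C_n^r) = \mathsf{D}^{\ast}(C_n^r).\] Additionally, \[\mathsf{SD}_k(C_n^3)\ge \mathsf{D}^{\ast}(C_n^3) - \max \left\{1,\; n -k-2- \left\lfloor \frac{-1 + \sqrt{1+ 8\max\{n-3-k, 0\}}}{2} \right\rfloor \right\}.\]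
   Context: $\mathbb{N}$ and $\mathbb{N}_0$ denote the positive and the non-negative integers; $C_n$ is a cyclic group of order $n$; groups are written additively. For a finite abelian group $G\cong C_{n_1}\oplus\dots\oplus C_{n_r}$ with $1<n_1\mid\dots\mid n_r$, set $\mathsf{D}^{\ast}(G)=1+\sum_{i=1}^r(n_i-1)$; thus $\mathsf{D}^{\ast}(C_n^r)=r(n-1)+1$. A sequence over $G$ is a finite multiset $S$ of elements of $G$; its length $|S|$ is the number of terms counted with multiplicity, and $\mathsf{v}_g(S)$ is the multiplicity of $g$ in $S$. A minimal zero-sum sequence is a non-empty sequence whose terms sum to $0$ and none of whose proper non-empty subsequences has sum $0$. The Davenport constant $\mathsf{D}(G)$ is the maximal length of a minimal zero-sum sequence over $G$. The cumulated multiplicity of $S$ is $\mathrm{cm}(S)=\sum_{g\in G}\max\{0,\mathsf{v}_g(S)-1\}$. The $k$-th Strong Davenport constant $\mathsf{SD}_k(G)$ is the maximal length of a minimal zero-sum sequence $S$ over $G$ with $\mathrm{cm}(S)\le k$. *)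

theory Defs
  imports
    Complex_Main
    "HOL-Library.Multiset"
    "HOL-Number_Theory.Prime_Powers"
    "HOL-Algebra.Algebra"
begin

text \<open>
  Groups are \<^locale>\<open>comm_group\<close> records of HOL-Algebra, which are written multiplicatively:
  the unit plays the role of $0$ and \<open>g [^] m\<close> that of $m g$.
\<close>

definition cyclic_sum :: "nat list \<Rightarrow> (nat \<Rightarrow> int) monoid" where
  "cyclic_sum ns = product_group {..<length ns} (\<lambda>i. integer_mod_group (ns ! i))"

definition cyclic_power :: "nat \<Rightarrow> nat \<Rightarrow> (nat \<Rightarrow> int) monoid" where
  "cyclic_power n r = product_group {..<r} (\<lambda>_. integer_mod_group n)"

text \<open>
  The list is $(n_1, \dots, n_r)$ with $1 < n_1 \mid \dots \mid n_r$; it is empty for the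
  trivial group.
\<close>

definition is_invariants :: "('a, 'b) monoid_scheme \<Rightarrow> nat list \<Rightarrow> bool" where
  "is_invariants G ns \<longleftrightarrow>
     (\<forall>m \<in> set ns. 1 < m) \<and>
     (\<forall>i. Suc i < length ns \<longrightarrow> ns ! i dvd ns ! Suc i) \<and>
     G \<cong> cyclic_sum ns"

definition group_invariants :: "('a, 'b) monoid_scheme \<Rightarrow> nat list" where
  "group_invariants G = (THE ns. is_invariants G ns)"

definition Dstar :: "('a, 'b) monoid_scheme \<Rightarrow> nat" where
  "Dstar G = 1 + (\<Sum>m \<leftarrow> group_invariants G. m - 1)"

definition seq_sum :: "('a, 'b) monoid_scheme \<Rightarrow> 'a multiset \<Rightarrow> 'a" where
  "seq_sum G S = (\<Otimes>\<^bsub>G\<^esub>g \<in> set_mset S. g [^]\<^bsub>G\<^esub> count S g)"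

definition min_zero_sum :: "('a, 'b) monoid_scheme \<Rightarrow> 'a multiset \<Rightarrow> bool" where
  "min_zero_sum G S \<longleftrightarrow>
     set_mset S \<subseteq> carrier G \<and> S \<noteq> {#} \<and> seq_sum G S = \<one>\<^bsub>G\<^esub> \<and>
     (\<forall>T. T \<subset># S \<longrightarrow> T \<noteq> {#} \<longrightarrow> seq_sum G T \<noteq> \<one>\<^bsub>G\<^esub>)"

text \<open>The truncated subtraction on \<^typ>\<open>nat\<close> is $\max\{0, \mathsf{v}_g(S) - 1\}$.\<close>

definition cumulated_mult :: "('a, 'b) monoid_scheme \<Rightarrow> 'a multiset \<Rightarrow> nat" where
  "cumulated_mult G S = (\<Sum>g \<in> carrier G. count S g - 1)"

text \<open>
  For a finite group, the maxima below are over finite non-empty sets: a minimal zero-sum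
  sequence has length at most the order of \<open>G\<close>, and the sequence consisting of a single unit
  is one with cumulated multiplicity $0$.
\<close>

definition davenport :: "('a, 'b) monoid_scheme \<Rightarrow> nat" where
  "davenport G = Max {size S | S. min_zero_sum G S}"

definition strong_davenport :: "nat \<Rightarrow> ('a, 'b) monoid_scheme \<Rightarrow> nat" where
  "strong_davenport k G = Max {size S | S. min_zero_sum G S \<and> cumulated_mult G S \<le> k}"


text \<open>
  The rest of this theory checks that \<^const>\<open>group_invariants\<close> and \<^const>\<open>Dstar\<close> have the
  expected values for $C_n^r$.
\<close>

lemma group_cyclic_sum: "group (cyclic_sum ns)"
  unfolding cyclic_sum_def by (rule product_group) simp

lemma cyclic_power_eq: "cyclic_power n r = cyclic_sum (replicate r n)"
  unfolding cyclic_power_def cyclic_sum_def product_group_def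
  by (auto simp: fun_eq_iff PiE_def Pi_def restrict_def)

lemma pow_cyclic_sum:
  assumes "x \<in> carrier (cyclic_sum ns)"
  shows "x [^]\<^bsub>cyclic_sum ns\<^esub> (d::nat) =
           (\<lambda>i\<in>{..<length ns}. (int d * x i) mod int (ns ! i))"
  using assms
  by (induction d)
     (auto simp: cyclic_sum_def fun_eq_iff restrict_def ring_distribs mod_simps add.commute)

lemma carrier_cyclic_sum:
  assumes "\<And>m. m \<in> set ns \<Longrightarrow> m > 0"
  shows "carrier (cyclic_sum ns) = (\<Pi>\<^sub>E i\<in>{..<length ns}. {0..<int (ns ! i)})"
proof -
  have "ns ! i \<noteq> 0" if "i < length ns" for i
    using assms[OF nth_mem[OF that]] by simp
  then show ?thesis
    unfolding cyclic_sum_def carrier_product_group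
    by (intro PiE_cong) (simp add: carrier_integer_mod_group)
qed

lemma torsion_card:
  assumes "d > 0" "\<And>m. m \<in> set ns \<Longrightarrow> m > 0 \<and> d dvd m"
  shows "card {x \<in> carrier (cyclic_sum ns). x [^]\<^bsub>cyclic_sum ns\<^esub> d = \<one>\<^bsub>cyclic_sum ns\<^esub>}
           = d ^ length ns"
proof -
  let ?A = "\<lambda>i. {x \<in> {0..<int (ns ! i)}. (int d * x) mod int (ns ! i) = 0}"
  have "{x \<in> carrier (cyclic_sum ns). x [^]\<^bsub>cyclic_sum ns\<^esub> d = \<one>\<^bsub>cyclic_sum ns\<^esub>}
          = PiE {..<length ns} ?A" (is "?L = ?R")
  proof (rule Set.set_eqI)
    fix x
    have carrier: "carrier (cyclic_sum ns) = (\<Pi>\<^sub>E i\<in>{..<length ns}. {0..<int (ns ! i)})"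
      using assms(2) by (intro carrier_cyclic_sum) auto
    have one: "\<one>\<^bsub>cyclic_sum ns\<^esub> = (\<lambda>i\<in>{..<length ns}. 0)"
      by (simp add: cyclic_sum_def)
    have "x [^]\<^bsub>cyclic_sum ns\<^esub> d = \<one>\<^bsub>cyclic_sum ns\<^esub> \<longleftrightarrow>
            (\<forall>i<length ns. (int d * x i) mod int (ns ! i) = 0)" if "x \<in> carrier (cyclic_sum ns)"
      unfolding pow_cyclic_sum[OF that] one by (auto simp: fun_eq_iff restrict_def)
    then show "x \<in> ?L \<longleftrightarrow> x \<in> ?R"
      unfolding carrier by (auto simp: PiE_iff)
  qed
  moreover have "card (?A i) = d" if "i < length ns" for i
  proof -
    from assms(2)[OF nth_mem[OF that]] obtain e where e: "ns ! i = d * e" "e > 0"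
      by auto
    have "?A i = (\<lambda>j. int (e * j)) ` {..<d}"
    proof (intro equalityI subsetI)
      fix x assume x: "x \<in> ?A i"
      then have "int d * int e dvd int d * x" by (auto simp: e mod_eq_0_iff_dvd)
      then have "int e dvd x" using assms(1) by simp
      then obtain c where c: "x = int e * c" by auto
      from x have "0 \<le> int e * c" "int e * c < int e * int d"
        by (auto simp: e c mult.commute)
      then have "0 \<le> c" "c < int d"
        using e(2) by (auto simp: zero_le_mult_iff)
      then have "x = int (e * nat c)" "nat c < d" by (auto simp: c)
      then show "x \<in> (\<lambda>j. int (e * j)) ` {..<d}" by blast
    next
      fix x assume "x \<in> (\<lambda>j. int (e * j)) ` {..<d}"
      then obtain j where j: "x = int (e * j)" "j < d" by auto
      have "e * j < d * e" using j e by (simp add: mult.commute)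
      then have "x < int (ns ! i)" unfolding j(1) e(1) using of_nat_less_iff by blast
      moreover have "int (ns ! i) dvd int d * x" by (simp add: j e)
      ultimately show "x \<in> ?A i" by (auto simp: j)
    qed
    moreover have "inj_on (\<lambda>j. int (e * j)) {..<d}" using e(2) by (auto simp: inj_on_def)
    ultimately show ?thesis by (simp add: card_image)
  qed
  ultimately show ?thesis by (simp add: card_PiE)
qed

lemma card_cyclic_sum:
  assumes "\<And>m. m \<in> set ns \<Longrightarrow> m > 0"
  shows "card (carrier (cyclic_sum ns)) = prod_list ns"
  by (simp add: carrier_cyclic_sum[OF assms] card_PiE prod.list_conv_set_nth atLeast0LessThan)

lemma iso_torsion_card:
  assumes "group G" "group H" "G \<cong> H"
  shows "card {x \<in> carrier G. x [^]\<^bsub>G\<^esub> (d::nat) = \<one>\<^bsub>G\<^esub>} =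
         card {x \<in> carrier H. x [^]\<^bsub>H\<^esub> d = \<one>\<^bsub>H\<^esub>}"
proof -
  obtain h where h: "h \<in> iso G H" using assms(3) by (auto simp: is_iso_def)
  interpret group_hom G H h
    using h assms by (auto simp: group_hom_def group_hom_axioms_def iso_def)
  from h have bij: "bij_betw h (carrier G) (carrier H)" by (simp add: iso_def)
  have eq: "h x [^]\<^bsub>H\<^esub> d = \<one>\<^bsub>H\<^esub> \<longleftrightarrow> x [^]\<^bsub>G\<^esub> d = \<one>\<^bsub>G\<^esub>" if "x \<in> carrier G" for x
  proof -
    have "h x [^]\<^bsub>H\<^esub> d = h (x [^]\<^bsub>G\<^esub> d)" using that by (simp add: hom_nat_pow)
    moreover have "h (x [^]\<^bsub>G\<^esub> d) = h \<one>\<^bsub>G\<^esub> \<longleftrightarrow> x [^]\<^bsub>G\<^esub> d = \<one>\<^bsub>G\<^esub>"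
      using bij that by (intro inj_on_eq_iff[where A = "carrier G"]) (auto simp: bij_betw_def)
    ultimately show ?thesis by simp
  qed
  have "h ` {x \<in> carrier G. x [^]\<^bsub>G\<^esub> d = \<one>\<^bsub>G\<^esub>} = {x \<in> carrier H. x [^]\<^bsub>H\<^esub> d = \<one>\<^bsub>H\<^esub>}"
  proof (intro equalityI subsetI)
    fix y assume "y \<in> h ` {x \<in> carrier G. x [^]\<^bsub>G\<^esub> d = \<one>\<^bsub>G\<^esub>}"
    then obtain x where "x \<in> carrier G" "x [^]\<^bsub>G\<^esub> d = \<one>\<^bsub>G\<^esub>" "y = h x" by blast
    then show "y \<in> {x \<in> carrier H. x [^]\<^bsub>H\<^esub> d = \<one>\<^bsub>H\<^esub>}" using eq[of x] by simp
  next
    fix y assume y: "y \<in> {x \<in> carrier H. x [^]\<^bsub>H\<^esub> d = \<one>\<^bsub>H\<^esub>}"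
    then obtain x where "x \<in> carrier G" "y = h x" using bij by (auto simp: bij_betw_def)
    then show "y \<in> h ` {x \<in> carrier G. x [^]\<^bsub>G\<^esub> d = \<one>\<^bsub>G\<^esub>}" using y eq[of x] by simp
  qed
  then have "bij_betw h {x \<in> carrier G. x [^]\<^bsub>G\<^esub> d = \<one>\<^bsub>G\<^esub>} {x \<in> carrier H. x [^]\<^bsub>H\<^esub> d = \<one>\<^bsub>H\<^esub>}"
    by (rule bij_betw_subset[OF bij, rotated]) blast
  then show ?thesis by (rule bij_betw_same_card)
qed

lemma prod_list_eq_power_imp:
  assumes "\<And>m. m \<in> set ms \<Longrightarrow> m > 0 \<and> m \<le> n" "prod_list ms = n ^ length ms"
  shows "ms = replicate (length ms) (n::nat)"
  using assms
proof (induction ms)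
  case (Cons a ms)
  have bound: "prod_list xs \<le> n ^ length xs" if "\<And>m. m \<in> set xs \<Longrightarrow> m \<le> n" for xs :: "nat list"
    using that by (induction xs) (auto intro!: mult_le_mono)
  have le: "prod_list ms \<le> n ^ length ms" using Cons.prems(1) by (intro bound) auto
  have a: "0 < a" "a \<le> n" using Cons.prems(1)[of a] by auto
  have eq: "a * prod_list ms = n * n ^ length ms" using Cons.prems(2) by simp
  have "a = n"
  proof (rule ccontr)
    assume "a \<noteq> n"
    then have "a * n ^ length ms < n * n ^ length ms" using a by simp
    moreover have "a * prod_list ms \<le> a * n ^ length ms" using le by simp
    ultimately show False using eq by linarith
  qed
  with eq a have "prod_list ms = n ^ length ms" by simp
  with Cons \<open>a = n\<close> show ?case by auto
qed simp

lemma is_invariants_cyclic_power_iff: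
  assumes n: "n > 1"
  shows "is_invariants (cyclic_power n r) ms \<longleftrightarrow> ms = replicate r n"
proof
  assume "ms = replicate r n"
  then show "is_invariants (cyclic_power n r) ms"
    using n by (auto simp: is_invariants_def cyclic_power_eq iso_refl)
next
  assume inv: "is_invariants (cyclic_power n r) ms"
  then have gt: "\<And>m. m \<in> set ms \<Longrightarrow> 1 < m"
    and dvd: "\<And>i. Suc i < length ms \<Longrightarrow> ms ! i dvd ms ! Suc i"
    and iso: "cyclic_sum (replicate r n) \<cong> cyclic_sum ms"
    by (auto simp: is_invariants_def cyclic_power_eq)
  note tors = iso_torsion_card[OF group_cyclic_sum group_cyclic_sum iso]
  have pos: "\<And>m. m \<in> set ms \<Longrightarrow> 0 < m" using gt by force
  have hd_dvd: "ms ! 0 dvd ms ! i" if "i < length ms" for i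
    using that
  proof (induction i)
    case (Suc i)
    then show ?case using dvd[of i] by (auto intro: dvd_trans)
  qed simp
  have card_eq: "prod_list ms = n ^ r"
    using iso_same_card[OF iso] card_cyclic_sum[of "replicate r n"] card_cyclic_sum[OF pos] n
    by (auto simp: prod_list_replicate)
  have dvd_n: "m dvd n" if "m \<in> set ms" for m
  proof -
    let ?T = "{x \<in> carrier (cyclic_sum ms). x [^]\<^bsub>cyclic_sum ms\<^esub> n = \<one>\<^bsub>cyclic_sum ms\<^esub>}"
    have "card ?T = n ^ length (replicate r n)"
      unfolding tors[of n, symmetric] by (rule torsion_card) (use n in auto)
    then have "card ?T = n ^ r" by simp
    moreover have c: "card (carrier (cyclic_sum ms)) = n ^ r"
      using card_eq card_cyclic_sum[OF pos] by simp
    moreover have "finite (carrier (cyclic_sum ms))"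
      using c n by (intro card_ge_0_finite) simp
    ultimately have T: "?T = carrier (cyclic_sum ms)"
      by (metis (no_types, lifting) card_subset_eq mem_Collect_eq subsetI)
    from that obtain i where i: "i < length ms" "m = ms ! i" by (auto simp: in_set_conv_nth)
    let ?x = "\<lambda>j\<in>{..<length ms}. 1::int"
    have "ms ! j \<noteq> 1" if "j < length ms" for j using gt[OF nth_mem[OF that]] by simp
    then have x: "?x \<in> carrier (cyclic_sum ms)"
      by (auto simp: cyclic_sum_def)
    with T have "?x [^]\<^bsub>cyclic_sum ms\<^esub> n = \<one>\<^bsub>cyclic_sum ms\<^esub>" by blast
    then have "(?x [^]\<^bsub>cyclic_sum ms\<^esub> n) i = \<one>\<^bsub>cyclic_sum ms\<^esub> i" by simp
    then have "int n mod int (ms ! i) = 0"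
      using i(1) unfolding pow_cyclic_sum[OF x] by (simp add: cyclic_sum_def)
    then show ?thesis using i by (simp flip: zmod_int add: mod_eq_0_iff_dvd)
  qed
  have len: "length ms = r"
  proof (cases "ms = []")
    case True
    then show ?thesis using card_eq n by (cases r) auto
  next
    case False
    let ?d = "ms ! 0"
    have d: "?d \<in> set ms" using False by (simp add: nth_mem)
    have "?d ^ length (replicate r n) = ?d ^ length ms"
      using tors[of ?d]
      by (subst (asm) (1 2) torsion_card)
         (use pos d dvd_n[OF d] n hd_dvd in \<open>auto simp: in_set_conv_nth\<close>)
    then show ?thesis using gt[OF d] by (simp add: power_inject_exp)
  qed
  have "ms = replicate (length ms) n"
    using pos dvd_n n card_eq len by (intro prod_list_eq_power_imp) (auto intro: dvd_imp_le)
  then show "ms = replicate r n" using len by simp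
qed

lemma Dstar_cyclic_power:
  assumes "n > 1"
  shows "Dstar (cyclic_power n r) = r * (n - 1) + 1"
proof -
  have "group_invariants (cyclic_power n r) = replicate r n"
    by (simp add: group_invariants_def is_invariants_cyclic_power_iff[OF assms])
  then show ?thesis by (simp add: Dstar_def sum_list_replicate)
qed

end

theory Submission
  imports Defs "HOL-Number_Theory.Cong"
begin

text \<open>
  Every sequence over $C_n^r$ is handled as a finite family of integer vectors with $r$
  coordinates, and sums are taken modulo $n$. In this form a sequence $S$ has
  $\mathrm{cm}(S) \le k$ exactly if its length exceeds its number of distinct residue vectors by at
  most $k$.

  All lower bounds come from one exchange principle (\<open>attains_substitute\<close>). From a minimal
  zero-sum sequence over $C_n^r$ remove some terms $(g_i)_{i \in M}$, and add vectors with further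
  coordinates. Suppose that each subfamily of the new vectors that vanishes in the new coordinates
  has, in the old ones, the sum of some of the $g_i$, where only the empty subfamily gives the empty
  sum and only the whole family gives the full sum. Then the result is again a minimal zero-sum
  sequence: a zero-sum subsequence of it becomes one of the original sequence. If
  the new vectors are pairwise distinct, then each removed repetition lowers the cumulated
  multiplicity by one.

  For one new coordinate, a term $g$ is traded for $n$ vectors $e + a_j$ with $\sum_j a_j = g$: the
  new coordinate vanishes only for none or all of them. If the old rank is at least $2$ then the
  $a_j$ can be distinct, and this gains $n - 1$ in length and $1$ in cumulated multiplicity
  (\<open>attains_Suc_rank\<close>). Over $C_n$ itself it fails, because $n$ distinct elements of
  $C_n$ have a prescribed sum. Three new coordinates at once repair this: the blocks
  $e_i^{n-2}\,(e_i + e_{i+1})\,(e_i - e_{i+1})$, with indices modulo $m = 3$ and suitable entries in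
  $C_n$, are linked cyclically. The price is a family of unwanted zero-sum subsequences
  that take from each block exactly one of its two special vectors (\<open>cyclic_blocks_zero_sums\<close>).
  The entries in $C_n$ can be chosen so that these have sum $g_0$ or $g_1 + g_2$, which the exchange
  principle permits. This is the step from $C_n$ to $C_n^4$, and \<open>attains_Suc_rank\<close> leads from
  there to every larger rank (\<open>attains_from_cyclic\<close>). For $C_n^3$ the same blocks with $m = 2$
  replace three terms equal to $1$.

  The explicit bounds follow by starting from $1^{K+1}\, 2\, 3 \cdots t$ over $C_n$, where
  positive integers with sum $n$ form a minimal zero-sum sequence and $t(t+1)/2 \le n - K$.

  For a prime power $n = p^e$, the upper bound on the Davenport constant comes from the polynomial
  $\prod_{c<r} \binom{s_c + n - 1}{n - 1}$ in the coordinates $s_c$ of a subset sum. It is divisible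
  by $p$ unless $n$ divides every $s_c$, and it has degree $r (n - 1)$, so that its alternating sum
  over all subsets of a larger index set is zero (\<open>prime_power_zero_sum_subset\<close>). The
  term of the empty set is $1$, so some other subset must have sum zero in $C_n^r$.
\<close>

section \<open>Minimal zero-sum families of integer vectors\<close>

definition zero_sum_on :: "nat \<Rightarrow> nat \<Rightarrow> ('i \<Rightarrow> nat \<Rightarrow> int) \<Rightarrow> 'i set \<Rightarrow> bool" where
  "zero_sum_on n r f J \<longleftrightarrow> (\<forall>c<r. int n dvd (\<Sum>i\<in>J. f i c))"

definition min_zero_sum_family :: "nat \<Rightarrow> nat \<Rightarrow> ('i \<Rightarrow> nat \<Rightarrow> int) \<Rightarrow> 'i set \<Rightarrow> bool" where
  "min_zero_sum_family n r f I \<longleftrightarrow>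
     finite I \<and> I \<noteq> {} \<and> zero_sum_on n r f I \<and>
     (\<forall>J\<subseteq>I. zero_sum_on n r f J \<longrightarrow> J = {} \<or> J = I)"

text \<open>
  The representative of \<open>v\<close> in the carrier of \<^const>\<open>cyclic_power\<close>: restricted to the first
  \<open>r\<close> coordinates and reduced modulo \<open>n\<close>.
\<close>

definition residues_upto :: "nat \<Rightarrow> nat \<Rightarrow> (nat \<Rightarrow> int) \<Rightarrow> nat \<Rightarrow> int" where
  "residues_upto n r v = (\<lambda>c\<in>{..<r}. v c mod int n)"

text \<open>
  There is a minimal zero-sum sequence of length \<open>l\<close> over $C_n^r$ with cumulated multiplicity at
  most \<open>k\<close>: the cumulated multiplicity of a sequence is its length minus its number of distinct terms.
\<close>

definition attains :: "nat \<Rightarrow> nat \<Rightarrow> nat \<Rightarrow> nat \<Rightarrow> bool" where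
  "attains n r k l \<longleftrightarrow>
     (\<exists>f :: nat \<Rightarrow> nat \<Rightarrow> int. min_zero_sum_family n r f {..<l} \<and>
        l \<le> k + card ((\<lambda>i. residues_upto n r (f i)) ` {..<l}))"

lemma residues_upto_eq_iff:
  "residues_upto n r u = residues_upto n r v \<longleftrightarrow> (\<forall>c<r. [u c = v c] (mod int n))"
  by (auto simp: residues_upto_def fun_eq_iff restrict_def cong_def)

lemma zero_sum_on_reindex:
  assumes "inj_on h J"
  shows "zero_sum_on n r f (h ` J) \<longleftrightarrow> zero_sum_on n r (f \<circ> h) J"
  using assms by (simp add: zero_sum_on_def sum.reindex)

text \<open>
  Constructions index their families by whatever is convenient; only the size of the index set matters.
\<close>

lemma attainsI:
  assumes min: "min_zero_sum_family n r f I"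
    and cm: "card I \<le> k + card ((\<lambda>i. residues_upto n r (f i)) ` I)"
  shows "attains n r k (card I)"
proof -
  have "finite I" using min by (simp add: min_zero_sum_family_def)
  then obtain h where h: "bij_betw h {..<card I} I"
    using ex_bij_betw_nat_finite[of I] by (auto simp: atLeast0LessThan)
  then have inj: "inj_on h {..<card I}" and im: "h ` {..<card I} = I"
    by (auto simp: bij_betw_def)
  have "min_zero_sum_family n r (f \<circ> h) {..<card I}"
    unfolding min_zero_sum_family_def
  proof (intro conjI allI impI)
    show "{..<card I} \<noteq> {}" "zero_sum_on n r (f \<circ> h) {..<card I}"
      using min im inj by (auto simp: min_zero_sum_family_def simp flip: zero_sum_on_reindex)
    fix J assume J: "J \<subseteq> {..<card I}" "zero_sum_on n r (f \<circ> h) J"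
    then have "zero_sum_on n r f (h ` J)"
      using inj by (simp add: zero_sum_on_reindex inj_on_subset)
    moreover have "h ` J \<subseteq> I" using J(1) im by blast
    ultimately have "h ` J = {} \<or> h ` J = h ` {..<card I}"
      using min im by (auto simp: min_zero_sum_family_def)
    then show "J = {} \<or> J = {..<card I}"
      using inj J(1) by (auto simp: inj_on_image_eq_iff)
  qed simp
  moreover have "(\<lambda>i. residues_upto n r (f i)) ` h ` {..<card I} =
      (\<lambda>i. residues_upto n r ((f \<circ> h) i)) ` {..<card I}"
    by (simp add: image_image)
  ultimately show ?thesis unfolding attains_def using cm im by (intro exI[of _ "f \<circ> h"]) simp
qed

lemma attains_mono: "attains n r k l \<Longrightarrow> k \<le> k' \<Longrightarrow> attains n r k' l"
  by (force simp: attains_def)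

lemma attains_pos: "attains n r k l \<Longrightarrow> 0 < l"
  by (auto simp: attains_def min_zero_sum_family_def)

lemma attains_one: "attains n r k 1"
  unfolding attains_def
  by (rule exI[of _ "\<lambda>_ _. 0"])
    (auto simp: min_zero_sum_family_def zero_sum_on_def lessThan_Suc subset_singleton_iff)

text \<open>
  The sums of the nonempty initial segments are distinct in $C_n^r$: two equal ones would differ by
  a zero-sum segment that misses the first term.
\<close>

lemma attains_length_le:
  assumes "0 < n" "attains n r k l"
  shows "l \<le> n ^ r"
proof -
  obtain f :: "nat \<Rightarrow> nat \<Rightarrow> int" where f: "min_zero_sum_family n r f {..<l}"
    using assms(2) by (auto simp: attains_def)
  \<comment> \<open>segments start at 0 and are nonempty, so the sum ends at \<open>j\<close> inclusively\<close>
  define P where "P j = residues_upto n r (\<lambda>c. \<Sum>i<Suc j. f i c)" for j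
  have "inj_on P {..<l}"
  proof (rule linorder_inj_onI)
    fix j j' assume j: "j < j'" "j \<in> {..<l}" "j' \<in> {..<l}"
    have "(\<Sum>i<Suc j'. f i c) = (\<Sum>i<Suc j. f i c) + (\<Sum>i\<in>{Suc j..<Suc j'}. f i c)" for c
      using sum.atLeastLessThan_concat[of 0 "Suc j" "Suc j'" "\<lambda>i. f i c"] j(1)
      by (simp add: atLeast0LessThan)
    then have diff: "(\<Sum>i\<in>{Suc j..<Suc j'}. f i c) = (\<Sum>i<Suc j'. f i c) - (\<Sum>i<Suc j. f i c)" for c
      by simp
    show "P j \<noteq> P j'"
    proof
      assume "P j = P j'"
      then have "zero_sum_on n r f {Suc j..<Suc j'}"
        unfolding zero_sum_on_def diff P_def residues_upto_eq_iff
        by (auto simp: cong_iff_dvd_diff dvd_diff_commute)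
      moreover have "{Suc j..<Suc j'} \<subseteq> {..<l}" using j by auto
      ultimately have "{Suc j..<Suc j'} = {} \<or> {Suc j..<Suc j'} = {..<l}"
        using f unfolding min_zero_sum_family_def by blast
      moreover have "0 \<in> {..<l}" "0 \<notin> {Suc j..<Suc j'}" using j by auto
      ultimately show False using j(1) by auto
    qed
  qed auto
  moreover have "P ` {..<l} \<subseteq> (\<Pi>\<^sub>E c\<in>{..<r}. {0..<int n})"
    using assms(1) by (force simp: P_def residues_upto_def PiE_iff extensional_def)
  ultimately have "card {..<l} \<le> card (\<Pi>\<^sub>E c\<in>{..<r}. {0..<int n})"
    by (intro card_inj_on_le) (auto intro: finite_PiE)
  then show ?thesis by (simp add: card_PiE)
qed

section \<open>Trading terms for a block in new coordinates\<close>

text \<open>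
  As long as \<open>h\<close> identifies two indices, removing one of them costs no value of \<open>h\<close>; afterwards
  the excess \<open>card I - card (h ` I)\<close> is zero and stays so.
\<close>

lemma exists_removable_subset:
  assumes "finite I" "m \<le> card I" "card I \<le> k + m + card (h ` I)"
  shows "\<exists>M\<subseteq>I. card M = m \<and> card (I - M) \<le> k + card (h ` (I - M))"
  using assms
proof (induction m arbitrary: I)
  case 0
  then show ?case by (intro exI[of _ "{}"]) auto
next
  case (Suc m)
  have "\<exists>i\<in>I. card (I - {i}) \<le> k + m + card (h ` (I - {i}))"
  proof (cases "inj_on h I")
    case True
    from Suc.prems obtain i where "i \<in> I" by fastforce
    moreover have "inj_on h (I - {i})" using True by (rule inj_on_subset) auto
    ultimately show ?thesis by (intro bexI[of _ i]) (auto simp: card_image)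
  next
    case False
    then obtain i j where ij: "i \<in> I" "j \<in> I" "i \<noteq> j" "h i = h j" by (auto simp: inj_on_def)
    then have "h ` (I - {i}) = h ` I" by (auto simp: image_iff)
    then show ?thesis using Suc.prems ij by (intro bexI[of _ i]) auto
  qed
  then obtain i where i: "i \<in> I" "card (I - {i}) \<le> k + m + card (h ` (I - {i}))" by blast
  have "m \<le> card (I - {i})" using Suc.prems i by simp
  then obtain M where M: "M \<subseteq> I - {i}" "card M = m"
      "card (I - {i} - M) \<le> k + card (h ` (I - {i} - M))"
    using Suc.IH[of "I - {i}"] Suc.prems i by blast
  have "I - insert i M = I - {i} - M" by auto
  moreover have "card (insert i M) = Suc m" 
    using M Suc.prems by (subst card_insert_disjoint) (auto intro: finite_subset)
  ultimately show ?case using M i(1) by (intro exI[of _ "insert i M"]) auto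
qed

text \<open>
  The exchange principle. A subfamily of the new sequence consists of some \<open>A \<subseteq> I - M\<close> and some
  \<open>K' \<subseteq> K\<close>. If it has sum zero then \<open>K'\<close> vanishes in the coordinates \<open>r..<r'\<close>, where \<open>t\<close>
  is extended by zero, so \<open>K'\<close> may be replaced by some \<open>M' \<subseteq> M\<close> with the same sum, and minimality of
  \<open>t\<close> applies to \<open>A \<union> M'\<close>. The last two hypotheses make the traded vectors distinct from each other
  and from all that is kept.
\<close>

lemma attains_substitute:
  fixes t :: "'i \<Rightarrow> nat \<Rightarrow> int" and w :: "'k \<Rightarrow> nat \<Rightarrow> int"
  assumes t: "min_zero_sum_family n r t I" and M: "M \<subseteq> I" "M \<noteq> {}" and K: "finite K" "K \<noteq> {}" and r: "r \<le> r'"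
    and new: "\<And>c. r \<le> c \<Longrightarrow> c < r' \<Longrightarrow> int n dvd (\<Sum>x\<in>K. w x c)"
    and old: "\<And>c. c < r \<Longrightarrow> [\<Sum>x\<in>K. w x c = \<Sum>i\<in>M. t i c] (mod int n)"
    and sub: "\<And>K'. K' \<subseteq> K \<Longrightarrow> (\<And>c. r \<le> c \<Longrightarrow> c < r' \<Longrightarrow> int n dvd (\<Sum>x\<in>K'. w x c)) \<Longrightarrow>
        K' = {} \<or> K' = K \<or>
        (\<exists>M'. M' \<noteq> {} \<and> M' \<subset> M \<and> (\<forall>c<r. [\<Sum>x\<in>K'. w x c = \<Sum>i\<in>M'. t i c] (mod int n)))"
    and cm: "card (I - M) \<le> k + card ((\<lambda>i. residues_upto n r (t i)) ` (I - M))"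
    and inj: "inj_on (\<lambda>x. residues_upto n r' (w x)) K"
    and nontriv: "\<And>x. x \<in> K \<Longrightarrow> \<exists>c. r \<le> c \<and> c < r' \<and> \<not> int n dvd w x c"
  shows "attains n r' k (card I - card M + card K)"
proof -
  have fin: "finite I" "finite M" "finite (I - M)"
    using t M by (auto simp: min_zero_sum_family_def intro: finite_subset)
  define f where "f = case_sum (\<lambda>i c. if c < r then t i c else 0) w"
  define L where "L = (I - M) <+> K"
  have sum_f: "(\<Sum>x\<in>A <+> B. f x c) = (if c < r then \<Sum>i\<in>A. t i c else 0) + (\<Sum>x\<in>B. w x c)"
    if "finite A" "finite B" for A B c
    using that by (simp add: sum.Plus f_def)
  have I_t: "int n dvd (\<Sum>i\<in>I. t i c)" if "c < r" for c
    using t that by (simp add: min_zero_sum_family_def zero_sum_on_def)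
  have split: "(\<Sum>i\<in>I. t i c) = (\<Sum>i\<in>I - M. t i c) + (\<Sum>i\<in>M. t i c)" for c
    using sum.subset_diff[OF M(1) fin(1)] .
  have "min_zero_sum_family n r' f L"
    unfolding min_zero_sum_family_def
  proof (intro conjI allI impI)
    show "finite L" "L \<noteq> {}" using fin K by (auto simp: L_def)
    show "zero_sum_on n r' f L"
      unfolding zero_sum_on_def
    proof (intro allI impI)
      fix c assume c: "c < r'"
      show "int n dvd (\<Sum>x\<in>L. f x c)"
      proof (cases "c < r")
        case True
        have "[(\<Sum>i\<in>I - M. t i c) + (\<Sum>x\<in>K. w x c) = (\<Sum>i\<in>I. t i c)] (mod int n)"
          unfolding split using old[OF True] by (intro cong_add) auto
        then have "int n dvd (\<Sum>i\<in>I - M. t i c) + (\<Sum>x\<in>K. w x c)"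
          using I_t[OF True] cong_dvd_iff by blast
        then show ?thesis using True fin K by (simp add: L_def sum_f)
      qed (use new c fin K in \<open>simp add: L_def sum_f\<close>)
    qed
    fix J assume J: "J \<subseteq> L" "zero_sum_on n r' f J"
    define A where "A = Inl -` J"
    define K' where "K' = Inr -` J"
    have J_eq: "J = A <+> K'" unfolding A_def K'_def
      by (auto simp: Plus_def image_iff) (metis sum.exhaust)
    have A: "A \<subseteq> I - M" and K': "K' \<subseteq> K" using J(1) by (auto simp: A_def K'_def L_def)
    have finAK: "finite A" "finite K'" using A K' fin K by (auto intro: finite_subset)
    have z: "int n dvd (if c < r then \<Sum>i\<in>A. t i c else 0) + (\<Sum>x\<in>K'. w x c)" if "c < r'" for c
      using J(2) that sum_f[OF finAK] by (simp add: J_eq zero_sum_on_def)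
    have union: "A \<union> M' = {} \<or> A \<union> M' = I"
      if "M' \<subseteq> M" "\<forall>c<r. [\<Sum>x\<in>K'. w x c = \<Sum>i\<in>M'. t i c] (mod int n)" for M'
    proof -
      have "finite M'" "A \<inter> M' = {}" using that(1) A fin by (auto intro: finite_subset)
      then have un: "(\<Sum>i\<in>A \<union> M'. t i c) = (\<Sum>i\<in>A. t i c) + (\<Sum>i\<in>M'. t i c)" for c
        using finAK by (simp add: sum.union_disjoint)
      have "int n dvd (\<Sum>i\<in>A \<union> M'. t i c)" if c: "c < r" for c
      proof -
        have "[(\<Sum>i\<in>A. t i c) + (\<Sum>x\<in>K'. w x c) = (\<Sum>i\<in>A \<union> M'. t i c)] (mod int n)"
          unfolding un using \<open>\<forall>c<r. _\<close> c by (intro cong_add) auto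
        moreover have "int n dvd (\<Sum>i\<in>A. t i c) + (\<Sum>x\<in>K'. w x c)" using z[of c] c r by simp
        ultimately show ?thesis by (rule cong_dvd_iff[THEN iffD1])
      qed
      then have "zero_sum_on n r t (A \<union> M')" by (simp add: zero_sum_on_def)
      moreover have "A \<union> M' \<subseteq> I" using A M(1) that(1) by blast
      ultimately show ?thesis using t unfolding min_zero_sum_family_def by blast
    qed
    have "int n dvd (\<Sum>x\<in>K'. w x c)" if "r \<le> c" "c < r'" for c
      using z[OF that(2)] that(1) by simp
    then consider "K' = {}" | "K' = K" | M' where "M' \<noteq> {}" "M' \<subset> M"
        "\<forall>c<r. [\<Sum>x\<in>K'. w x c = \<Sum>i\<in>M'. t i c] (mod int n)"
      using sub[OF K'] by blast
    then show "J = {} \<or> J = L"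
    proof cases
      case 1
      have "A = {} \<or> A = I" using union[of "{}"] 1 by simp
      then show ?thesis using 1 A M by (auto simp: J_eq)
    next
      case 2
      then have "A \<union> M = {} \<or> A \<union> M = I" using union[of M] old by simp
      then have "A = I - M" using A M by blast
      then show ?thesis using 2 by (simp add: J_eq L_def)
    next
      case 3
      then have "A \<union> M' = {} \<or> A \<union> M' = I" using union[of M'] by blast
      then show ?thesis using 3 A M by blast
    qed
  qed
  moreover have "card L \<le> k + card ((\<lambda>x. residues_upto n r' (f x)) ` L)"
  proof -
    let ?R = "\<lambda>x. residues_upto n r' (f x)"
    have im: "?R ` L = ?R ` Inl ` (I - M) \<union> ?R ` Inr ` K" by (auto simp: L_def)
    have "?R (Inl i) \<noteq> ?R (Inr x)" if "x \<in> K" for i x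
    proof -
      obtain c where c: "r \<le> c" "c < r'" "\<not> int n dvd w x c"
        using nontriv \<open>x \<in> K\<close> by blast
      then have "\<not> [f (Inr x) c = f (Inl i) c] (mod int n)" by (simp add: f_def cong_0_iff)
      then show ?thesis using c(2) unfolding residues_upto_eq_iff by (blast intro: cong_sym)
    qed
    then have disj: "?R ` Inl ` (I - M) \<inter> ?R ` Inr ` K = {}" by blast
    have "?R ` Inr ` K = (\<lambda>x. residues_upto n r' (w x)) ` K" by (simp add: image_image f_def)
    then have cK: "card (?R ` Inr ` K) = card K" using inj by (simp add: card_image)
    have "(\<lambda>i. residues_upto n r (t i)) ` (I - M) = (\<lambda>v. restrict v {..<r}) ` ?R ` Inl ` (I - M)"
      unfolding image_image using r by (intro image_cong refl) (auto simp: residues_upto_def f_def fun_eq_iff)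
    then have "card ((\<lambda>i. residues_upto n r (t i)) ` (I - M)) \<le> card (?R ` Inl ` (I - M))"
      using fin by (simp add: card_image_le)
    moreover have "card (?R ` L) = card (?R ` Inl ` (I - M)) + card K"
      unfolding im using disj cK fin K by (subst card_Un_disjoint) auto
    ultimately show ?thesis using cm fin K by (simp add: L_def card_Plus)
  qed
  ultimately have "attains n r' k (card L)" by (rule attainsI)
  moreover have "card L = card I - card M + card K"
    using fin K M by (simp add: L_def card_Plus card_Diff_subset)
  ultimately show ?thesis by (simp only:)
qed

section \<open>Raising the rank by one\<close>

text \<open>
  Start with \<open>v\<close> consecutive integers. Shifting all of them by one adds \<open>v\<close> to the sum, and shifting
  only the last \<open>p < v\<close> of them adds \<open>p\<close>, so every residue is reached. All values lie in a
  window of \<open>v + 1 \<le> n\<close> consecutive integers and therefore stay distinct modulo \<open>n\<close>.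
\<close>

lemma distinct_residues_with_sum:
  assumes v: "1 \<le> v" "v < n"
  shows "\<exists>a :: nat \<Rightarrow> int. (\<forall>i<v. \<forall>j<v. [a i = a j] (mod int n) \<longrightarrow> i = j) \<and>
           [\<Sum>i<v. a i = s] (mod int n)"
proof -
  define d where "d = nat ((s - (\<Sum>i<v. int i)) mod int n)"
  define p where "p = d mod v"
  define a where "a i = int (i + d div v + (if v - p \<le> i then 1 else 0))" for i
  have p: "p < v" using v by (simp add: p_def)
  have "i = j" if ij: "i < v" "j < v" "[a i = a j] (mod int n)" for i j
  proof -
    have "\<bar>a i - a j\<bar> < int n" using ij(1,2) v by (auto simp: a_def)
    moreover have "int n dvd a i - a j" using ij(3) by (simp add: cong_iff_dvd_diff)
    ultimately have "a i = a j"
      using dvd_imp_le_int[of "a i - a j" "int n"] by linarith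
    then show ?thesis by (auto simp: a_def split: if_splits)
  qed
  moreover have "(\<Sum>i<v. a i) = (\<Sum>i<v. int i) + int d"
  proof -
    have "{i. i < v \<and> v - p \<le> i} = {v - p..<v}" by auto
    then have "(\<Sum>i<v. if v - p \<le> i then 1 else 0) = int p"
      using p by (simp flip: sum.inter_filter)
    then have "(\<Sum>i<v. a i) = (\<Sum>i<v. int i) + (int v * int (d div v) + int p)"
      by (simp add: a_def sum.distrib if_distrib[of int] cong: if_cong)
    also have "int v * int (d div v) + int p = int d"
      unfolding p_def by (metis mult_div_mod_eq of_nat_add of_nat_mult)
    finally show ?thesis .
  qed
  moreover have "int d = (s - (\<Sum>i<v. int i)) mod int n" using v by (simp add: d_def)
  ultimately show ?thesis
    by (intro exI[of _ a]) (auto simp: cong_def mod_simps)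
qed

lemma sum_split_last_two:
  fixes h :: "nat \<Rightarrow> 'b::comm_monoid_add"
  assumes "2 \<le> n"
  shows "(\<Sum>j<n. h j) = (\<Sum>j<n - 2. h j) + h (n - 2) + h (n - 1)"
proof -
  obtain m where "n = Suc (Suc m)" using assms by (metis Suc_le_D numeral_2_eq_2 Suc_le_mono)
  then show ?thesis by simp
qed

text \<open>
  One term \<open>g\<close> is traded for \<open>n\<close> vectors with new coordinate \<open>1\<close>. Of these, \<open>n - 2\<close> vary only in
  coordinate \<open>0\<close>, with any prescribed sum; the other two are told apart from them by coordinate \<open>1\<close>,
  where they have nonzero entries \<open>e\<close> and \<open>g 1 - e\<close>. This is where \<open>r \<ge> 2\<close> is needed.
\<close>

lemma attains_Suc_rank:
  assumes n: "3 \<le> n" and r: "2 \<le> r" and l: "attains n r (Suc k) l"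
  shows "attains n (Suc r) k (l + (n - 1))"
proof -
  obtain t :: "nat \<Rightarrow> nat \<Rightarrow> int" where t: "min_zero_sum_family n r t {..<l}"
      "l \<le> Suc k + card ((\<lambda>i. residues_upto n r (t i)) ` {..<l})"
    using l by (auto simp: attains_def)
  have lpos: "0 < l" using attains_pos[OF l] .
  obtain M where M: "M \<subseteq> {..<l}" "card M = 1"
      "card ({..<l} - M) \<le> k + card ((\<lambda>i. residues_upto n r (t i)) ` ({..<l} - M))"
    using exists_removable_subset[of "{..<l}" 1 k "\<lambda>i. residues_upto n r (t i)"] t(2) lpos by auto
  then obtain i where Mi: "M = {i}" by (auto simp: card_1_singleton_iff)
  define g where "g = t i"
  obtain a where a: "\<And>i j. i < n - 2 \<Longrightarrow> j < n - 2 \<Longrightarrow> [a i = a j] (mod int n) \<Longrightarrow> i = j"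
      "[\<Sum>i<n - 2. a i = g 0 - 1] (mod int n)"
    using distinct_residues_with_sum[of "n - 2" n "g 0 - 1"] n by fastforce
  \<comment> \<open>neither \<open>e\<close> nor \<open>g 1 - e\<close> may vanish: \<open>1\<close> works unless \<open>g 1\<close> is \<open>1\<close> modulo \<open>n\<close>, and then \<open>- 1\<close> does as \<open>n\<close> does not divide \<open>2\<close>\<close>
  define e :: int where "e = (if int n dvd g 1 - 1 then - 1 else 1)"
  have e: "\<not> int n dvd e" "\<not> int n dvd g 1 - e"
  proof -
    show "\<not> int n dvd e" using n by (auto simp: e_def)
    show "\<not> int n dvd g 1 - e"
    proof (cases "int n dvd g 1 - 1")
      case True
      have "\<not> int n dvd 2" using n by (auto dest: zdvd_imp_le)
      moreover have "g 1 - e = (g 1 - 1) + 2" using True by (simp add: e_def)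
      ultimately show ?thesis using True by (metis dvd_add_right_iff)
    qed (simp add: e_def)
  qed
  define w where "w j = (\<lambda>c. if c = r then 1
      else if j < n - 2 then (if c = 0 then a j else 0)
      else if j = n - 2 then (if c = 1 then e else 0)
      else if c = 0 then 1 else if c = 1 then g 1 - e else g c)" for j
  have sum_w: "(\<Sum>j<n. w j c) = (\<Sum>j<n - 2. w j c) + w (n - 2) c + w (n - 1) c" for c
    using n by (intro sum_split_last_two) simp
  have last: "n - Suc 0 \<noteq> n - 2" "\<not> n - Suc 0 < n - 2" using n by linarith+
  have "attains n (Suc r) k (card {..<l} - card M + card {..<n})"
  proof (rule attains_substitute[OF t(1) M(1), where w = w])
    show "M \<noteq> {}" "finite {..<n}" "{..<n} \<noteq> {}" "r \<le> Suc r" using Mi n by (auto simp: lessThan_empty_iff)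
    show "int n dvd (\<Sum>x<n. w x c)" if "r \<le> c" "c < Suc r" for c
      using that by (simp add: w_def)
    show "[\<Sum>x<n. w x c = \<Sum>i\<in>M. t i c] (mod int n)" if c: "c < r" for c
    proof -
      consider "c = 0" | "c = 1" | "2 \<le> c" by linarith
      then show ?thesis
      proof cases
        case 1
        then have "(\<Sum>x<n. w x c) = (\<Sum>j<n - 2. a j) + 1"
          unfolding sum_w using last r by (simp add: w_def)
        then show ?thesis using cong_add[OF a(2) cong_refl[of 1]] 1 by (simp add: Mi g_def)
      next
        case 2
        then have "(\<Sum>x<n. w x c) = g 1" unfolding sum_w using last r c by (simp add: w_def)
        then show ?thesis using 2 by (simp add: Mi g_def)
      next
        case 3
        then have "(\<Sum>x<n. w x c) = g c" unfolding sum_w using last r c by (simp add: w_def)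
        then show ?thesis by (simp add: Mi g_def)
      qed
    qed
    show "K' = {} \<or> K' = {..<n} \<or>
        (\<exists>M'. M' \<noteq> {} \<and> M' \<subset> M \<and> (\<forall>c<r. [\<Sum>x\<in>K'. w x c = \<Sum>i\<in>M'. t i c] (mod int n)))"
      if K': "K' \<subseteq> {..<n}" and dvd: "\<And>c. r \<le> c \<Longrightarrow> c < Suc r \<Longrightarrow> int n dvd (\<Sum>x\<in>K'. w x c)" for K'
    proof -
      have "n dvd card K'" using dvd[of r] by (simp add: w_def)
      moreover have "card K' \<le> n" using K' card_mono[of "{..<n}" K'] by simp
      ultimately have "card K' = 0 \<or> card K' = n" using dvd_imp_le by fastforce
      then show ?thesis
        using K' card_subset_eq[of "{..<n}" K'] finite_subset[OF K'] by auto
    qed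
    show "card ({..<l} - M) \<le> k + card ((\<lambda>i. residues_upto n r (t i)) ` ({..<l} - M))"
      by (rule M(3))
    show "inj_on (\<lambda>x. residues_upto n (Suc r) (w x)) {..<n}"
    proof (rule linorder_inj_onI)
      fix i j assume ij: "i < j" "i \<in> {..<n}" "j \<in> {..<n}"
      have "\<exists>c<Suc r. \<not> [w i c = w j c] (mod int n)"
      proof -
        consider "j < n - 2" | "i < n - 2" "j = n - 2" | "i < n - 2" "j = n - 1" | "i = n - 2" "j = n - 1"
          using ij by fastforce
        then show ?thesis
        proof cases
          case 1
          then have "\<not> [w i 0 = w j 0] (mod int n)" using a(1)[of i j] ij(1) r by (auto simp: w_def)
          then show ?thesis by blast
        next
          case 2
          then have "\<not> [w j 1 = w i 1] (mod int n)" using e(1) r by (simp add: w_def cong_0_iff)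
          then show ?thesis using r cong_sym by (metis One_nat_def Suc_le_lessD le_SucI numeral_2_eq_2)
        next
          case 3
          then have "\<not> [w j 1 = w i 1] (mod int n)" using e(2) r last by (simp add: w_def cong_0_iff)
          then show ?thesis using r cong_sym by (metis One_nat_def Suc_le_lessD le_SucI numeral_2_eq_2)
        next
          case 4
          then have "\<not> [w j 0 = w i 0] (mod int n)" using r n last by (simp add: w_def cong_0_iff)
          then show ?thesis using cong_sym by blast
        qed
      qed
      then show "residues_upto n (Suc r) (w i) \<noteq> residues_upto n (Suc r) (w j)"
        unfolding residues_upto_eq_iff by blast
    qed auto
    show "\<exists>c\<ge>r. c < Suc r \<and> \<not> int n dvd w x c" for x
      using n by (intro exI[of _ r]) (auto simp: w_def)
  qed
  moreover have "card {..<l} - card M + card {..<n} = l + (n - 1)" using M(2) lpos n by simp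
  ultimately show ?thesis by simp
qed

section \<open>Long sequences over cyclic groups\<close>

lemma min_zero_sum_family_positive:
  fixes u :: "'i \<Rightarrow> int"
  assumes "finite I" "I \<noteq> {}" "\<And>i. i \<in> I \<Longrightarrow> 0 < u i" "(\<Sum>i\<in>I. u i) = int n"
  shows "min_zero_sum_family n 1 (\<lambda>i _. u i) I"
  unfolding min_zero_sum_family_def
proof (intro conjI allI impI)
  show "zero_sum_on n 1 (\<lambda>i _. u i) I" using assms(4) by (simp add: zero_sum_on_def)
  fix J assume J: "J \<subseteq> I" "zero_sum_on n 1 (\<lambda>i _. u i) J"
  show "J = {} \<or> J = I"
  proof (rule ccontr)
    assume "\<not> (J = {} \<or> J = I)"
    then have ne: "J \<noteq> {}" "I - J \<noteq> {}" using J(1) by auto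
    have "(\<Sum>i\<in>I. u i) = (\<Sum>i\<in>I - J. u i) + (\<Sum>i\<in>J. u i)"
      by (rule sum.subset_diff[OF J(1) assms(1)])
    moreover have "0 < (\<Sum>i\<in>I - J. u i)" "0 < (\<Sum>i\<in>J. u i)"
      using ne J(1) assms(1,3) by (auto intro!: sum_pos intro: finite_subset)
    ultimately have "0 < (\<Sum>i\<in>J. u i)" "(\<Sum>i\<in>J. u i) < int n" using assms(4) by auto
    moreover have "int n dvd (\<Sum>i\<in>J. u i)" using J(2) by (simp add: zero_sum_on_def)
    ultimately show False using zdvd_imp_le[of "int n" "\<Sum>i\<in>J. u i"] by linarith
  qed
qed (use assms in auto)

text \<open>
  The sequence is $1^K$ followed by $1, 2, \dots, t$, where the last term is enlarged to reach the
  sum \<open>N\<close>. If \<open>t = 0\<close> there is no such term to enlarge, hence the second hypothesis.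
\<close>

lemma staircase:
  assumes t: "2 * K + t * (t + 1) \<le> 2 * N" and exact: "t = 0 \<Longrightarrow> K = N"
  shows "\<exists>u :: nat \<Rightarrow> int. (\<Sum>i<K + t. u i) = int N \<and> (\<forall>i<K + t. 0 < u i) \<and> inj_on u {K..<K + t}"
proof -
  define v where "v i = (if i < K then 1 else int (i - K) + 1)" for i
  define rest where "rest = int N - (\<Sum>i<K + t. v i)"
  define u where "u i = v i + (if i = K + t - 1 then rest else 0)" for i
  have sum_v: "2 * (\<Sum>i<K + m. v i) = int (2 * K + m * (m + 1))" for m
    by (induction m) (auto simp: v_def algebra_simps)
  have "int (2 * K + t * (t + 1)) \<le> int (2 * N)" using t by (simp only: of_nat_le_iff)
  then have rest: "0 \<le> rest" using sum_v[of t] by (simp add: rest_def)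
  have zero: "rest = 0" if "t = 0" using sum_v[of 0] exact[OF that] that by (simp add: rest_def)
  have "(\<Sum>i<K + t. u i) = int N"
  proof (cases "K + t = 0")
    case True
    then show ?thesis using exact by simp
  next
    case False
    then show ?thesis by (simp add: u_def sum.distrib rest_def)
  qed
  moreover have "0 < u i" for i using rest by (simp add: u_def v_def)
  moreover have "inj_on u {K..<K + t}"
    by (rule linorder_inj_onI) (use rest in \<open>auto simp: u_def v_def\<close>)
  ultimately show ?thesis by blast
qed

lemma card_le_card_image_residues:
  fixes u :: "nat \<Rightarrow> int"
  assumes inj: "inj_on u {K..<L}" and bound: "\<And>i. i < L \<Longrightarrow> 0 < u i \<and> u i \<le> int n" and "K \<le> L"
  shows "L \<le> K + card ((\<lambda>i. residues_upto n 1 (\<lambda>_. u i)) ` {..<L})"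
proof -
  have "inj_on (\<lambda>i. residues_upto n 1 (\<lambda>_. u i)) {K..<L}"
  proof (rule inj_onI)
    fix i j assume ij: "i \<in> {K..<L}" "j \<in> {K..<L}"
      "residues_upto n 1 (\<lambda>_. u i) = residues_upto n 1 (\<lambda>_. u j)"
    then have "int n dvd u i - u j" by (auto simp: residues_upto_eq_iff cong_iff_dvd_diff)
    moreover have "\<bar>u i - u j\<bar> < int n" using bound[of i] bound[of j] ij(1,2) by auto
    ultimately have "u i = u j"
      using dvd_imp_le_int[of "u i - u j" "int n"] by linarith
    then show "i = j" using inj ij(1,2) by (auto dest: inj_onD)
  qed
  then have "L - K = card ((\<lambda>i. residues_upto n 1 (\<lambda>_. u i)) ` {K..<L})" by (simp add: card_image)
  also have "\<dots> \<le> card ((\<lambda>i. residues_upto n 1 (\<lambda>_. u i)) ` {..<L})"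
    by (intro card_mono image_mono) auto
  finally show ?thesis using \<open>K \<le> L\<close> by simp
qed

lemma attains_cyclic_staircase:
  assumes "1 \<le> n" "2 * K + t * (t + 1) \<le> 2 * n" "t = 0 \<Longrightarrow> K = n"
  shows "attains n 1 K (K + t)"
proof -
  obtain u :: "nat \<Rightarrow> int" where u: "(\<Sum>i<K + t. u i) = int n" "\<And>i. i < K + t \<Longrightarrow> 0 < u i"
      "inj_on u {K..<K + t}"
    using staircase[OF assms(2,3)] by blast
  have ne: "{..<K + t} \<noteq> {}" using assms by (cases "t = 0") (auto simp: lessThan_empty_iff)
  have "u i \<le> int n" if "i < K + t" for i
    using member_le_sum[of i "{..<K + t}" u] that u by force
  then show ?thesis
    using attainsI[OF min_zero_sum_family_positive[of "{..<K + t}" u n], of K]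
      card_le_card_image_residues[OF u(3), of n] u ne
    by auto
qed

section \<open>Cyclically linked blocks\<close>

text \<open>
  The \<open>j\<close>-th vector of block \<open>i\<close>. Coordinate \<open>0\<close> is that of the given cyclic group, and coordinate
  \<open>Suc i\<close> belongs to $e_i$. With indices modulo \<open>m\<close>, the block consists of \<open>n - 2\<close> vectors
  $e_i$ with the entries \<open>a i j\<close> in coordinate \<open>0\<close>, of $e_i + e_{i+1}$ with \<open>x i\<close> (at
  \<open>j = n - 2\<close>), and of $e_i - e_{i+1}$ with \<open>y i\<close> (at \<open>j = n - 1\<close>).
\<close>

definition block_term ::
    "nat \<Rightarrow> nat \<Rightarrow> (nat \<Rightarrow> nat \<Rightarrow> int) \<Rightarrow> (nat \<Rightarrow> int) \<Rightarrow> (nat \<Rightarrow> int) \<Rightarrow> nat \<times> nat \<Rightarrow> nat \<Rightarrow> int" where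
  "block_term n m a x y = (\<lambda>(i, j) c.
     if c = 0 then (if j < n - 2 then a i j else if j = n - 2 then x i else y i)
     else of_bool (c - 1 = i)
          + of_bool (c - 1 = Suc i mod m) * (if j < n - 2 then 0 else if j = n - 2 then 1 else - 1))"

lemma sum_blocks:
  fixes h :: "nat \<times> nat \<Rightarrow> int"
  assumes K: "K \<subseteq> {..<m} \<times> {..<n}" and n: "2 \<le> n"
  shows "(\<Sum>z\<in>K. h z) = (\<Sum>i<m. (\<Sum>j | j < n - 2 \<and> (i, j) \<in> K. h (i, j))
           + of_bool ((i, n - 2) \<in> K) * h (i, n - 2) + of_bool ((i, n - 1) \<in> K) * h (i, n - 1))"
proof -
  have "(\<Sum>z\<in>K. h z) = (\<Sum>z\<in>{..<m} \<times> {..<n}. if z \<in> K then h z else 0)"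
    using K by (simp add: sum.inter_restrict[symmetric] Int_absorb1)
  also have "\<dots> = (\<Sum>i<m. \<Sum>j<n. if (i, j) \<in> K then h (i, j) else 0)"
    by (simp add: sum.cartesian_product)
  also have "\<dots> = (\<Sum>i<m. (\<Sum>j<n - 2. if (i, j) \<in> K then h (i, j) else 0)
           + of_bool ((i, n - 2) \<in> K) * h (i, n - 2) + of_bool ((i, n - 1) \<in> K) * h (i, n - 1))"
    using n by (intro sum.cong refl) (simp add: sum_split_last_two)
  also have "\<dots> = (\<Sum>i<m. (\<Sum>j | j < n - 2 \<and> (i, j) \<in> K. h (i, j))
           + of_bool ((i, n - 2) \<in> K) * h (i, n - 2) + of_bool ((i, n - 1) \<in> K) * h (i, n - 1))"
  proof -
    have "(\<Sum>j<n - 2. if (i, j) \<in> K then h (i, j) else 0) = (\<Sum>j | j < n - 2 \<and> (i, j) \<in> K. h (i, j))" for i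
      using sum.inter_filter[of "{..<n - 2}" "\<lambda>j. h (i, j)" "\<lambda>j. (i, j) \<in> K"] by simp
    then show ?thesis by (simp only:)
  qed
  finally show ?thesis .
qed

lemma bij_betw_Suc_mod: "bij_betw (\<lambda>i. Suc i mod m) {..<m} {..<m}"
proof -
  have "inj_on (\<lambda>i. Suc i mod m) {..<m}"
    by (rule inj_onI) (auto simp: mod_Suc split: if_splits)
  then show ?thesis
    unfolding bij_betw_def by (intro conjI endo_inj_surj) (auto intro!: mod_less_divisor)
qed

text \<open>
  A property that passes from each index to its cyclic successor holds everywhere if it holds once.
\<close>

lemma Suc_mod_closed:
  assumes i: "i < m" "Q i" and step: "\<And>i. i < m \<Longrightarrow> Q i \<Longrightarrow> Q (Suc i mod m)" and j: "j < m"
  shows "Q j"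
proof -
  have "Q ((i + d) mod m)" for d
  proof (induction d)
    case (Suc d)
    have "(i + d) mod m < m" using i by simp
    from step[OF this Suc] show ?case by (simp add: mod_Suc_eq)
  qed (use i in simp)
  from this[of "m + j - i"] show ?thesis using i j by simp
qed

text \<open>
  Let \<open>P i\<close> and \<open>N i\<close> tell whether the special vectors $e_i + e_{i+1}$ and $e_i - e_{i+1}$ occur.
  Coordinate $i + 1$ says that the number of ordinary vectors taken from block $i + 1$, plus
  $P_{i+1} + N_{i+1} + P_i - N_i$, is $0$ or $n$. Since a block has only $n - 2$ ordinary vectors, the
  added term is never $1$. If $P_i = N_i$ then this forces $P_{i+1} = N_{i+1}$, so around the
  cycle either all the pairs agree or none does. In the first case every block is taken
  completely or not at all. In the second case, block $i + 1$ contributes all its ordinary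
  vectors if $e_i + e_{i+1}$ was taken, and none if $e_i - e_{i+1}$ was; the set \<open>D\<close> records the
  former indices.
\<close>

lemma cyclic_blocks_zero_sums:
  assumes n: "3 \<le> n" and K: "K \<subseteq> {..<m} \<times> {..<n}"
    and dvd: "\<And>c. 1 \<le> c \<Longrightarrow> c < Suc m \<Longrightarrow> int n dvd (\<Sum>z\<in>K. block_term n m a x y z c)"
  shows "(\<exists>Q\<subseteq>{..<m}. K = Q \<times> {..<n}) \<or>
    (\<exists>D\<subseteq>{..<m}. \<forall>h :: nat \<times> nat \<Rightarrow> int. (\<Sum>z\<in>K. h z) =
       (\<Sum>i<m. if i \<in> D then h (i, n - 2) + (\<Sum>j<n - 2. h (Suc i mod m, j)) else h (i, n - 1)))"
proof -
  define A where "A i = {j. j < n - 2 \<and> (i, j) \<in> K}" for i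
  define P N :: "nat \<Rightarrow> int"
    where "P i = of_bool ((i, n - 2) \<in> K)" and "N i = of_bool ((i, n - 1) \<in> K)" for i
  have PN: "P i = 0 \<or> P i = 1" "N i = 0 \<or> N i = 1" for i by (auto simp: P_def N_def)
  have last: "n - Suc 0 \<noteq> n - 2" "\<not> n - Suc 0 < n - 2" using n by linarith+
  have n2: "2 \<le> n" using n by simp
  have finA: "finite (A i)" for i by (simp add: A_def)
  have A_le: "card (A i) \<le> n - 2" for i
    using card_mono[of "{..<n - 2}" "A i"] by (auto simp: A_def)
  have A_le': "int (card (A i)) \<le> int n - 2" for i using A_le[of i] n by linarith
  have A_empty: "A i = {}" if "card (A i) = 0" for i using that finA by simp
  have A_full: "A i = {..<n - 2}" if "2 + int (card (A i)) = int n" for i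
  proof -
    have "card (A i) = n - 2" using that n by linarith
    then show ?thesis
      using card_subset_eq[of "{..<n - 2}" "A i"] by (auto simp: A_def)
  qed
  have inj: "Suc i mod m = Suc i' mod m \<longleftrightarrow> i = i'" if "i < m" "i' < m" for i i'
    using bij_betw_Suc_mod[of m] that by (auto simp: bij_betw_def dest: inj_onD)
  have key: "int n dvd int (card (A (Suc i mod m))) + P (Suc i mod m) + N (Suc i mod m) + (P i - N i)"
    if i: "i < m" for i
  proof -
    let ?s = "Suc i mod m"
    have s: "?s < m" using i by simp
    have "(\<Sum>z\<in>K. block_term n m a x y z (Suc ?s)) =
        (\<Sum>i'<m. (if i' = ?s then int (card (A i')) + P i' + N i' else 0)
                  + (if i' = i then P i' - N i' else 0))"
      unfolding sum_blocks[OF K n2]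
    proof (rule sum.cong[OF refl])
      fix i' assume "i' \<in> {..<m}"
      then show "(\<Sum>j | j < n - 2 \<and> (i', j) \<in> K. block_term n m a x y (i', j) (Suc ?s))
          + of_bool ((i', n - 2) \<in> K) * block_term n m a x y (i', n - 2) (Suc ?s)
          + of_bool ((i', n - 1) \<in> K) * block_term n m a x y (i', n - 1) (Suc ?s)
          = (if i' = ?s then int (card (A i')) + P i' + N i' else 0)
                  + (if i' = i then P i' - N i' else 0)"
        using inj[OF i, of i'] last by (auto simp: block_term_def A_def P_def N_def)
    qed
    also have "\<dots> = int (card (A ?s)) + P ?s + N ?s + (P i - N i)"
      using s i by (simp add: sum.distrib)
    finally show ?thesis using dvd[of "Suc ?s"] s by simp
  qed
  have small: "e = 0 \<or> e = int n" if "int n dvd e" "- 1 \<le> e" "e \<le> int n + 1" for e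
  proof -
    from that(1) obtain q where q: "e = int n * q" by blast
    have "q < 2"
    proof (rule ccontr)
      assume "\<not> q < 2"
      then have "int n * 2 \<le> e" unfolding q by (intro mult_left_mono) auto
      then show False using that(3) n by linarith
    qed
    moreover have "- 1 < q"
    proof (rule ccontr)
      assume "\<not> - 1 < q"
      then have "e \<le> int n * (- 1)" unfolding q by (intro mult_left_mono) auto
      then show False using that(2) n by linarith
    qed
    ultimately show ?thesis using q by (cases "q = 0"; cases "q = 1") auto
  qed
  have eq: "int (card (A (Suc i mod m))) + P (Suc i mod m) + N (Suc i mod m) + (P i - N i) = 0 \<or>
      int (card (A (Suc i mod m))) + P (Suc i mod m) + N (Suc i mod m) + (P i - N i) = int n"
    if i: "i < m" for i
  proof -
    have "0 \<le> P i" "P i \<le> 1" "0 \<le> N i" "N i \<le> 1" for i using PN[of i] by auto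
    from this[of i] this[of "Suc i mod m"] show ?thesis
      using A_le'[of "Suc i mod m"] by (intro small key[OF i]) linarith+
  qed
  have step: "P (Suc i mod m) = N (Suc i mod m)" if "i < m" "P i = N i" for i
  proof (rule ccontr)
    assume "P (Suc i mod m) \<noteq> N (Suc i mod m)"
    then have "P (Suc i mod m) + N (Suc i mod m) = 1" using PN[of "Suc i mod m"] by auto
    then show False using eq[OF that(1)] that(2) A_le'[of "Suc i mod m"] n by linarith
  qed
  show ?thesis
  proof (cases "\<exists>i<m. P i = N i")
    case True
    then obtain i0 where "i0 < m" "P i0 = N i0" by blast
    then have PN_eq: "P i = N i" if "i < m" for i
      using Suc_mod_closed[of i0 m "\<lambda>i. P i = N i" i] step that by blast
    define Q where "Q = {i. i < m \<and> P i = 1}"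
    have full: "(i, j) \<in> K \<longleftrightarrow> P i = 1" if "i < m" "j < n" for i j
    proof -
      obtain i' where i': "i' < m" "i = Suc i' mod m"
        using bij_betw_Suc_mod[of m] \<open>i < m\<close> by (auto simp: bij_betw_def)
      have "A i = (if P i = 1 then {..<n - 2} else {})"
      proof -
        have sum: "int (card (A i)) + P i + P i = 0 \<or> int (card (A i)) + P i + P i = int n"
          using eq[OF i'(1), folded i'(2)] PN_eq[OF i'(1)] PN_eq[OF \<open>i < m\<close>] by linarith
        show ?thesis
        proof (cases "P i = 1")
          case True
          with sum have "2 + int (card (A i)) = int n" by linarith
          then show ?thesis using True A_full by simp
        next
          case False
          then have "P i = 0" using PN[of i] by blast
          with sum A_le'[of i] have "int (card (A i)) = 0" by linarith
          then have "A i = {}" by (intro A_empty) simp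
          then show ?thesis using False by simp
        qed
      qed
      then have "(i, j) \<in> K \<longleftrightarrow> P i = 1" if "j < n - 2" using that by (auto simp: A_def split: if_splits)
      moreover have "(i, n - 2) \<in> K \<longleftrightarrow> P i = 1" by (simp add: P_def)
      moreover have "(i, n - 1) \<in> K \<longleftrightarrow> P i = 1" using PN_eq[OF \<open>i < m\<close>] by (simp add: N_def)
      moreover have "j < n - 2 \<or> j = n - 2 \<or> j = n - 1" using \<open>j < n\<close> by linarith
      ultimately show ?thesis by blast
    qed
    have "K = Q \<times> {..<n}" using K full by (auto simp: Q_def)
    moreover have "Q \<subseteq> {..<m}" by (auto simp: Q_def)
    ultimately show ?thesis by blast
  next
    case False
    define D where "D = {i. i < m \<and> P i = 1}"
    have N_eq: "N i = 1 - P i" if "i < m" for i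
      using False PN[of i] that by auto
    have A_eq: "A (Suc i mod m) = (if i \<in> D then {..<n - 2} else {})" if i: "i < m" for i
    proof -
      let ?s = "Suc i mod m"
      have "?s < m" using i by simp
      then have sum: "int (card (A ?s)) + 2 * P i = 0 \<or> int (card (A ?s)) + 2 * P i = int n"
        using eq[OF i] N_eq[OF i] N_eq[of ?s] by linarith
      show ?thesis
      proof (cases "P i = 1")
        case True
        with sum have "2 + int (card (A ?s)) = int n" by linarith
        then show ?thesis using True A_full i by (simp add: D_def)
      next
        case False
        then have "P i = 0" using PN[of i] by blast
        with sum A_le'[of ?s] have "int (card (A ?s)) = 0" by linarith
        then have "A ?s = {}" by (intro A_empty) simp
        then show ?thesis using False by (simp add: D_def)
      qed
    qed
    have "(\<Sum>z\<in>K. h z) =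
       (\<Sum>i<m. if i \<in> D then h (i, n - 2) + (\<Sum>j<n - 2. h (Suc i mod m, j)) else h (i, n - 1))"
      for h :: "nat \<times> nat \<Rightarrow> int"
    proof -
      have "(\<Sum>z\<in>K. h z) = (\<Sum>i<m. (\<Sum>j\<in>A i. h (i, j))) + (\<Sum>i<m. P i * h (i, n - 2) + N i * h (i, n - 1))"
        unfolding sum_blocks[OF K n2] by (simp add: A_def P_def N_def sum.distrib)
      also have "(\<Sum>i<m. (\<Sum>j\<in>A i. h (i, j))) = (\<Sum>i<m. (\<Sum>j\<in>A (Suc i mod m). h (Suc i mod m, j)))"
        by (rule sum.reindex_bij_betw[OF bij_betw_Suc_mod, symmetric])
      also have "\<dots> + (\<Sum>i<m. P i * h (i, n - 2) + N i * h (i, n - 1)) =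
         (\<Sum>i<m. if i \<in> D then h (i, n - 2) + (\<Sum>j<n - 2. h (Suc i mod m, j)) else h (i, n - 1))"
        unfolding sum.distrib[symmetric]
      proof (rule sum.cong[OF refl])
        fix i assume "i \<in> {..<m}"
        then show "(\<Sum>j\<in>A (Suc i mod m). h (Suc i mod m, j)) + (P i * h (i, n - 2) + N i * h (i, n - 1)) =
          (if i \<in> D then h (i, n - 2) + (\<Sum>j<n - 2. h (Suc i mod m, j)) else h (i, n - 1))"
          using A_eq[of i] N_eq[of i] PN[of i] by (auto simp: D_def)
      qed
      finally show ?thesis .
    qed
    moreover have "D \<subseteq> {..<m}" by (auto simp: D_def)
    ultimately show ?thesis by blast
  qed
qed

text \<open>
  For \<open>m = 3\<close> the new coordinates separate all vectors but the ordinary ones of a single block. For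
  \<open>m = 2\<close> the two blocks share the vector $e_0 + e_1$, so that \<open>x\<close> has to separate its two copies.
\<close>

lemma block_term_inj:
  assumes n: "3 \<le> n" and m: "m = 3 \<or> m = 2 \<and> \<not> int n dvd x 0 - x 1"
    and a: "\<And>i j j'. j < n - 2 \<Longrightarrow> j' < n - 2 \<Longrightarrow> [a i j = a i j'] (mod int n) \<Longrightarrow> j = j'"
  shows "inj_on (\<lambda>z. residues_upto n (Suc m) (block_term n m a x y z)) ({..<m} \<times> {..<n})"
proof (rule inj_onI, clarify)
  fix i j i' j'
  assume ij: "i < m" "j < n" "i' < m" "j' < n"
    and "residues_upto n (Suc m) (block_term n m a x y (i, j)) = residues_upto n (Suc m) (block_term n m a x y (i', j'))"
  then have cong: "[block_term n m a x y (i, j) c = block_term n m a x y (i', j') c] (mod int n)" if "c < Suc m" for c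
    using that by (simp add: residues_upto_eq_iff)
  have dvd: "d = 0" if "int n dvd d" "\<bar>d\<bar> \<le> 2" for d :: int
    using dvd_imp_le_int[of d "int n"] that n by linarith
  define sg :: "nat \<Rightarrow> int" where "sg j = (if j < n - 2 then 0 else if j = n - 2 then 1 else - 1)" for j
  have coord: "of_bool (c = i) + of_bool (c = Suc i mod m) * sg j =
      of_bool (c = i') + of_bool (c = Suc i' mod m) * sg j'" if "c < m" for c
  proof -
    have "int n dvd (of_bool (c = i) + of_bool (c = Suc i mod m) * sg j) -
        (of_bool (c = i') + of_bool (c = Suc i' mod m) * sg j')"
      using cong[of "Suc c"] that by (simp add: block_term_def sg_def cong_iff_dvd_diff)
    moreover have "\<bar>of_bool (c = i) + of_bool (c = Suc i mod m) * sg j :: int\<bar> \<le> 1" if "i < m" for i j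
    proof -
      have "i \<noteq> Suc i mod m" using m that by (auto simp: mod_Suc)
      moreover have "\<bar>sg j\<bar> \<le> 1" by (simp add: sg_def)
      ultimately show ?thesis by (cases "c = i"; cases "c = Suc i mod m") simp_all
    qed
    from this[OF ij(1), of j] this[OF ij(3), of j']
    have "\<bar>(of_bool (c = i) + of_bool (c = Suc i mod m) * sg j) -
        (of_bool (c = i') + of_bool (c = Suc i' mod m) * sg j')\<bar> \<le> 2" by linarith
    ultimately have "(of_bool (c = i) + of_bool (c = Suc i mod m) * sg j) -
        (of_bool (c = i') + of_bool (c = Suc i' mod m) * sg j') = 0" by (rule dvd)
    then show ?thesis by simp
  qed
  have at_0: "block_term n m a x y (i, j) 0 = (if j < n - 2 then a i j else if j = n - 2 then x i else y i)" for i j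
    by (simp add: block_term_def)
  show "i = i' \<and> j = j'"
  proof (cases "i = i'")
    case True
    have "Suc i mod m < m" "Suc i mod m \<noteq> i" using ij m by (auto simp: mod_Suc)
    then have "sg j = sg j'" using coord[of "Suc i mod m"] True by simp
    then have "j < n - 2 \<and> j' < n - 2 \<or> j = j'" using ij n by (auto simp: sg_def split: if_splits)
    then show ?thesis using cong[of 0] a[of j j' i] True by (auto simp: at_0)
  next
    case False
    show ?thesis
    proof (cases "m = 3")
      case True
      then have "i' = Suc i mod m \<or> i = Suc i' mod m" using False ij by (auto simp: mod_Suc split: if_splits)
      then show ?thesis
        using coord[of i] coord[of i'] False ij True by (auto simp: mod_Suc split: if_splits)
    next
      case m2: False
      then have m2: "m = 2" "\<not> int n dvd x 0 - x 1" using m by auto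
      then have "i' = Suc i mod m" "i = Suc i' mod m" using False ij by (auto simp: mod_Suc split: if_splits)
      then have "sg j = 1" "sg j' = 1" using coord[of i] coord[of i'] False ij by auto
      then have "j = n - 2" "j' = n - 2" by (auto simp: sg_def split: if_splits)
      then have "int n dvd x i - x i'" using cong[of 0] by (simp add: at_0 cong_iff_dvd_diff)
      moreover have "i = 0 \<and> i' = 1 \<or> i = 1 \<and> i' = 0" using False ij m2 by auto
      ultimately show ?thesis using m2(2) by (auto simp: dvd_diff_commute)
    qed
  qed
qed

text \<open>
  Here \<open>s i\<close> is the sum of the entries of the ordinary vectors of block \<open>i\<close>, which can be prescribed
  even though these entries are distinct. The sums that have to be realised by removed terms are those
  of the two kinds of zero-sum subfamilies in \<open>cyclic_blocks_zero_sums\<close>.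
\<close>

lemma attains_cyclic_blocks:
  fixes t :: "'i \<Rightarrow> nat \<Rightarrow> int" and s x y :: "nat \<Rightarrow> int"
  assumes n: "3 \<le> n" and m: "m = 3 \<or> m = 2 \<and> \<not> int n dvd x 0 - x 1"
    and t: "min_zero_sum_family n 1 t I" and M: "M \<subseteq> I" "M \<noteq> {}"
    and cm: "card (I - M) \<le> k + card ((\<lambda>i. residues_upto n 1 (t i)) ` (I - M))"
    and total: "(\<Sum>i<m. s i + x i + y i) = (\<Sum>i\<in>M. t i 0)"
    and blocks: "\<And>Q. Q \<subset> {..<m} \<Longrightarrow> Q \<noteq> {} \<Longrightarrow>
        \<exists>M'. M' \<noteq> {} \<and> M' \<subset> M \<and> (\<Sum>i\<in>Q. s i + x i + y i) = (\<Sum>i\<in>M'. t i 0)"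
    and exotic: "\<And>D. D \<subseteq> {..<m} \<Longrightarrow>
        \<exists>M'. M' \<noteq> {} \<and> M' \<subset> M \<and>
          (\<Sum>i<m. if i \<in> D then x i + s (Suc i mod m) else y i) = (\<Sum>i\<in>M'. t i 0)"
  shows "attains n (Suc m) k (card I - card M + m * n)"
proof -
  have "\<exists>a :: nat \<Rightarrow> int. (\<forall>j<n - 2. \<forall>j'<n - 2. [a j = a j'] (mod int n) \<longrightarrow> j = j') \<and>
           [\<Sum>j<n - 2. a j = s i] (mod int n)" for i
    using n by (intro distinct_residues_with_sum) auto
  then obtain a :: "nat \<Rightarrow> nat \<Rightarrow> int" where
    a: "\<And>i. \<forall>j<n - 2. \<forall>j'<n - 2. [a i j = a i j'] (mod int n) \<longrightarrow> j = j'"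
      "\<And>i. [\<Sum>j<n - 2. a i j = s i] (mod int n)"
    by metis
  define w where "w = block_term n m a x y"
  define K where "K = {..<m} \<times> {..<n}"
  have last: "n - Suc 0 \<noteq> n - 2" "\<not> n - Suc 0 < n - 2" using n by linarith+
  have m2: "2 \<le> m" using m by auto
  have w0: "w (i, j) 0 = (if j < n - 2 then a i j else if j = n - 2 then x i else y i)" for i j
    by (simp add: w_def block_term_def)
  have sum_block: "[\<Sum>j<n. w (i, j) 0 = s i + x i + y i] (mod int n)" for i
  proof -
    have "(\<Sum>j<n. w (i, j) 0) = (\<Sum>j<n - 2. a i j) + x i + y i"
      using n last by (subst sum_split_last_two) (auto simp: w0)
    then show ?thesis using a(2)[of i] by (auto intro!: cong_add)
  qed
  have sum_Q: "[\<Sum>z\<in>Q \<times> {..<n}. w z 0 = \<Sum>i\<in>Q. s i + x i + y i] (mod int n)" for Q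
  proof -
    have "(\<Sum>z\<in>Q \<times> {..<n}. w z 0) = (\<Sum>i\<in>Q. \<Sum>j<n. w (i, j) 0)"
      by (simp add: sum.cartesian_product)
    then show ?thesis by (simp only:) (rule cong_sum[OF sum_block])
  qed
  have "attains n (Suc m) k (card I - card M + card K)"
  proof (rule attains_substitute[OF t M, where w = w])
    show "finite K" "K \<noteq> {}" "1 \<le> Suc m" using n m2 by (auto simp: K_def lessThan_empty_iff)
    show "int n dvd (\<Sum>z\<in>K. w z c)" if c: "1 \<le> c" for c
    proof -
      have "(\<Sum>z\<in>K. w z c) = (\<Sum>i<m. \<Sum>j<n. w (i, j) c)"
        by (simp add: K_def sum.cartesian_product)
      also have "\<dots> = (\<Sum>i<m. int n * of_bool (c - 1 = i))"
      proof (intro sum.cong refl)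
        fix i
        have "(\<Sum>j<n. w (i, j) c) = int (n - 2) * of_bool (c - 1 = i) + 2 * of_bool (c - 1 = i)"
          using n last c by (subst sum_split_last_two) (auto simp: w_def block_term_def)
        then show "(\<Sum>j<n. w (i, j) c) = int n * of_bool (c - 1 = i)"
          using n by (simp add: of_nat_diff algebra_simps)
      qed
      also have "int n dvd \<dots>" by (intro dvd_sum) simp
      finally show ?thesis .
    qed
    show "[\<Sum>z\<in>K. w z c = \<Sum>i\<in>M. t i c] (mod int n)" if "c < 1" for c
      using sum_Q[of "{..<m}"] that total by (simp add: K_def)
    show "K' = {} \<or> K' = K \<or>
        (\<exists>M'. M' \<noteq> {} \<and> M' \<subset> M \<and> (\<forall>c<1. [\<Sum>z\<in>K'. w z c = \<Sum>i\<in>M'. t i c] (mod int n)))"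
      if K': "K' \<subseteq> K" and dvd: "\<And>c. 1 \<le> c \<Longrightarrow> c < Suc m \<Longrightarrow> int n dvd (\<Sum>z\<in>K'. w z c)" for K'
    proof -
      consider Q where "Q \<subseteq> {..<m}" "K' = Q \<times> {..<n}"
        | D where "D \<subseteq> {..<m}" "\<forall>h :: nat \<times> nat \<Rightarrow> int. (\<Sum>z\<in>K'. h z) =
            (\<Sum>i<m. if i \<in> D then h (i, n - 2) + (\<Sum>j<n - 2. h (Suc i mod m, j)) else h (i, n - 1))"
        using cyclic_blocks_zero_sums[OF n K'[unfolded K_def], of a x y] dvd unfolding w_def by blast
      then show ?thesis
      proof cases
      case Q: (1 Q)
      show ?thesis
      proof (cases "Q = {} \<or> Q = {..<m}")
        case False
        then obtain M' where "M' \<noteq> {}" "M' \<subset> M" "(\<Sum>i\<in>Q. s i + x i + y i) = (\<Sum>i\<in>M'. t i 0)"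
          using blocks[of Q] Q(1) by blast
        then show ?thesis using sum_Q[of Q] Q(2) by (intro disjI2 exI[of _ M']) auto
      qed (use Q in \<open>auto simp: K_def\<close>)
    next
      case D: (2 D)
      have "(\<Sum>z\<in>K'. w z 0) = (\<Sum>i<m. if i \<in> D then x i + (\<Sum>j<n - 2. a (Suc i mod m) j) else y i)"
        unfolding D(2)[rule_format] using last by (intro sum.cong refl) (auto simp: w0)
      also have "[\<dots> = (\<Sum>i<m. if i \<in> D then x i + s (Suc i mod m) else y i)] (mod int n)"
        using a(2) by (intro cong_sum) (auto intro: cong_add)
      finally show ?thesis using exotic[OF D(1)] by (metis less_one)
    qed
    qed
    show "card (I - M) \<le> k + card ((\<lambda>i. residues_upto n 1 (t i)) ` (I - M))" by (rule cm)
    show "inj_on (\<lambda>z. residues_upto n (Suc m) (w z)) K"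
      unfolding w_def K_def using a(1) by (intro block_term_inj n m) blast
    show "\<exists>c\<ge>1. c < Suc m \<and> \<not> int n dvd w z c" if "z \<in> K" for z
    proof -
      obtain i j where z: "z = (i, j)" "i < m" using \<open>z \<in> K\<close> by (auto simp: K_def)
      then have "w z (Suc i) = 1" using m2 by (auto simp: w_def block_term_def mod_Suc)
      then show ?thesis using z n by (intro exI[of _ "Suc i"]) auto
    qed
  qed
  then show ?thesis by (simp add: K_def)
qed

text \<open>
  Three removed terms $g_0, g_1, g_2$ become the sums of the three blocks. The entries are chosen so
  that every unwanted zero-sum subfamily has sum $g_0$ or $g_1 + g_2$: in the contribution of an index
  $i$, which is $x_i + s_{i+1}$ or $y_i$, everything vanishes except for $i = 0$, where the two
  values are $g_1 + g_2$ and $g_0$.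
\<close>

lemma attains_rank_four:
  assumes n: "3 \<le> n" and l: "3 \<le> l" "attains n 1 (k + 3) l"
  shows "attains n 4 k (l + 3 * (n - 1))"
proof -
  obtain t :: "nat \<Rightarrow> nat \<Rightarrow> int" where t: "min_zero_sum_family n 1 t {..<l}"
      "l \<le> k + 3 + card ((\<lambda>i. residues_upto n 1 (t i)) ` {..<l})"
    using l by (auto simp: attains_def)
  obtain M where M: "M \<subseteq> {..<l}" "card M = 3"
      "card ({..<l} - M) \<le> k + card ((\<lambda>i. residues_upto n 1 (t i)) ` ({..<l} - M))"
    using exists_removable_subset[of "{..<l}" 3 k "\<lambda>i. residues_upto n 1 (t i)"] t(2) l by auto
  have "finite M" using M(1) finite_subset by blast
  then obtain h where h: "bij_betw h {..<3::nat} M"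
    using ex_bij_betw_nat_finite[of M] M(2) by (auto simp: atLeast0LessThan)
  then have inj: "inj_on h {..<3}" and im: "h ` {..<3} = M" by (auto simp: bij_betw_def)
  define g where "g i = t (h i) 0" for i
  have sum_g: "(\<Sum>i\<in>Q. g i) = (\<Sum>i\<in>h ` Q. t i 0)" if "Q \<subseteq> {..<3}" for Q
    using inj_on_subset[OF inj that] by (simp add: sum.reindex g_def)
  have proper: "h ` Q \<noteq> {} \<and> h ` Q \<subset> M" if "Q \<subset> {..<3}" "Q \<noteq> {}" for Q
    using inj_on_image_eq_iff[OF inj, of Q "{..<3}"] that im by auto
  \<comment> \<open>the solution of \<open>s i + x i + y i = g i\<close> for which \<open>x 1 + s 2\<close>, \<open>x 2 + s 0\<close>, \<open>y 1\<close> and \<open>y 2\<close> are zero\<close>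
  define s where "s i = (if i = 0 then 0 else if i = 1 then g 1 + g 2 else g 2)" for i :: nat
  define x where "x i = (if i = 1 then - g 2 else 0)" for i :: nat
  define y where "y i = (if i = 0 then g 0 else 0)" for i :: nat
  have sxy: "(\<Sum>i\<in>Q. s i + x i + y i) = (\<Sum>i\<in>Q. g i)" if "Q \<subseteq> {..<3}" for Q
  proof (rule sum.cong[OF refl])
    fix i assume "i \<in> Q"
    then have "i = 0 \<or> i = 1 \<or> i = 2" using that by auto
    then show "s i + x i + y i = g i" by (auto simp: s_def x_def y_def)
  qed
  have exotic: "\<exists>M'. M' \<noteq> {} \<and> M' \<subset> M \<and>
        (\<Sum>i<3. if i \<in> D then x i + s (Suc i mod 3) else y i) = (\<Sum>i\<in>M'. t i 0)" for D
  proof -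
    have three: "{..<3} = {0, 1, 2::nat}" by auto
    define Q :: "nat set" where "Q = (if 0 \<in> D then {1, 2} else {0})"
    have "Q \<subseteq> {..<3}" "Q \<noteq> {}" by (simp_all add: Q_def)
    moreover have "(if 0 \<in> D then 0 else 1) \<in> {..<3} - Q" by (simp add: Q_def)
    ultimately have Q: "Q \<subset> {..<3}" "Q \<noteq> {}" by blast+
    have "(\<Sum>i<3. if i \<in> D then x i + s (Suc i mod 3) else y i) = (\<Sum>i\<in>Q. g i)"
      by (simp add: three Q_def s_def x_def y_def)
    also have "\<dots> = (\<Sum>i\<in>h ` Q. t i 0)" by (rule sum_g[OF psubset_imp_subset[OF Q(1)]])
    finally have "(\<Sum>i<3. if i \<in> D then x i + s (Suc i mod 3) else y i) = (\<Sum>i\<in>h ` Q. t i 0)" .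
    with proper[OF Q] show ?thesis by (intro exI[of _ "h ` Q"]) (elim conjE, intro conjI)
  qed
  have "attains n (Suc 3) k (card {..<l} - card M + 3 * n)"
  proof (rule attains_cyclic_blocks[OF n _ t(1) M(1) _ M(3), where s = s and x = x and y = y])
    show "3 = (3::nat) \<or> (3::nat) = 2 \<and> \<not> int n dvd x 0 - x 1" "M \<noteq> {}" using M(2) by auto
    show "(\<Sum>i<3. s i + x i + y i) = (\<Sum>i\<in>M. t i 0)" using sxy sum_g im by simp
    show "\<exists>M'. M' \<noteq> {} \<and> M' \<subset> M \<and> (\<Sum>i\<in>Q. s i + x i + y i) = (\<Sum>i\<in>M'. t i 0)"
      if "Q \<subset> {..<3}" "Q \<noteq> {}" for Q
    proof -
      have Q3: "Q \<subseteq> {..<3}" by (rule psubset_imp_subset[OF that(1)])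
      have "(\<Sum>i\<in>Q. s i + x i + y i) = (\<Sum>i\<in>h ` Q. t i 0)"
        unfolding sxy[OF Q3] sum_g[OF Q3] ..
      with proper[OF that] show ?thesis by (intro exI[of _ "h ` Q"]) (elim conjE, intro conjI)
    qed
  qed (rule exotic)
  moreover have "card {..<l} - card M + 3 * n = l + 3 * (n - 1)" using M(2) l n by simp
  ultimately show ?thesis by simp
qed

text \<open>
  Passing to rank four uses up three units of cumulated multiplicity, and each further step one.
\<close>

lemma attains_from_cyclic:
  assumes n: "3 \<le> n" and r: "4 \<le> r" and l: "3 \<le> l" "attains n 1 (k + r - 1) l"
  shows "attains n r k (l + (r - 1) * (n - 1))"
  using r l(2)
proof (induction r arbitrary: k rule: dec_induct)
  case base
  then show ?case using attains_rank_four[OF n l(1), of k] by (simp add: add.commute)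
next
  case (step r)
  have "attains n r (Suc k) (l + (r - 1) * (n - 1))" using step.prems by (intro step.IH) simp
  then have "attains n (Suc r) k (l + (r - 1) * (n - 1) + (n - 1))"
    using step.hyps by (intro attains_Suc_rank n) auto
  moreover have "l + (r - 1) * (n - 1) + (n - 1) = l + (Suc r - 1) * (n - 1)"
    using step.hyps by (cases r) auto
  ultimately show ?case by (simp only:)
qed

text \<open>
  With only two blocks, both carry the vector $e_0 + e_1$, and its two copies need different entries.
  Therefore the removed terms are not arbitrary here: they are three copies of $1$, taken from a
  sequence of positive integers with sum $n$. The blocks have sums $2$ and $1$, and every other proper
  zero-sum subfamily has sum $1$ or $2$ as well, which is a sum of one or two of the removed terms.
\<close>

lemma attains_rank_three:
  assumes n: "3 \<le> n" and steps: "2 * k + t * (t + 1) \<le> 2 * (n - 3)" and exact: "t = 0 \<Longrightarrow> k = n - 3"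
  shows "attains n 3 k (k + t + 2 * n)"
proof -
  obtain u :: "nat \<Rightarrow> int" where u: "(\<Sum>i<k + t. u i) = int (n - 3)" "\<And>i. i < k + t \<Longrightarrow> 0 < u i"
      "inj_on u {k..<k + t}"
    using staircase[OF steps exact] by blast
  define v where "v i = (if i < k + t then u i else 1)" for i
  define I where "I = {..<k + t + 3}"
  define M where "M = {k + t..<k + t + 3}"
  have M: "M \<subseteq> I" "M \<noteq> {}" "I - M = {..<k + t}" by (auto simp: I_def M_def)
  have v_M: "(\<Sum>i\<in>A. v i) = int (card A)" if "A \<subseteq> M" for A
    using that by (subst sum.cong[of A A v "\<lambda>_. 1"]) (auto simp: v_def M_def)
  have "(\<Sum>i\<in>I. v i) = (\<Sum>i\<in>I - M. v i) + (\<Sum>i\<in>M. v i)"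
    by (rule sum.subset_diff[OF M(1)]) (simp add: I_def)
  also have "(\<Sum>i\<in>I - M. v i) = int (n - 3)" unfolding M(3) u(1)[symmetric] by (simp add: v_def)
  finally have sum_v: "(\<Sum>i\<in>I. v i) = int n" using v_M[of M] n by (simp add: M_def of_nat_diff)
  have v_pos: "0 < v i" for i using u(2) by (simp add: v_def)
  have v_le: "v i \<le> int n" if "i \<in> I" for i
    using member_le_sum[of i I v] that v_pos sum_v by (force simp: I_def less_imp_le)
  have min: "min_zero_sum_family n 1 (\<lambda>i _. v i) I"
    using M v_pos sum_v by (intro min_zero_sum_family_positive) (auto simp: I_def)
  have cm: "card (I - M) \<le> k + card ((\<lambda>i. residues_upto n 1 (\<lambda>_. v i)) ` (I - M))"
  proof -
    have "inj_on v {k..<k + t}" using u(3) by (simp add: inj_on_def v_def)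
    then have "k + t \<le> k + card ((\<lambda>i. residues_upto n 1 (\<lambda>_. v i)) ` {..<k + t})"
      using v_pos v_le by (intro card_le_card_image_residues) (auto simp: I_def)
    then show ?thesis by (simp add: M(3))
  qed
  define s :: "nat \<Rightarrow> int" where "s i = of_bool (i = 1)" for i
  define x :: "nat \<Rightarrow> int" where "x i = of_bool (i = 0)" for i
  \<comment> \<open>\<open>x\<close> also serves as \<open>y\<close>; index 0 contributes \<open>x 0 + s 1 = 2\<close> or \<open>x 0 = 1\<close> to an unwanted subfamily, and index 1 nothing\<close>
  have proper: "\<exists>M'. M' \<noteq> {} \<and> M' \<subset> M \<and> c = (\<Sum>i\<in>M'. v i)" if "c = 1 \<or> c = 2" for c :: int
  proof -
    let ?M' = "if c = 1 then {k + t} else {k + t, Suc (k + t)}"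
    have "k + t + 2 \<in> M - ?M'" "?M' \<subseteq> M" by (auto simp: M_def)
    moreover from this have "c = (\<Sum>i\<in>?M'. v i)" using v_M[of ?M'] that by auto
    ultimately show ?thesis by (intro exI[of _ ?M']) auto
  qed
  have "attains n (Suc 2) k (card I - card M + 2 * n)"
  proof (rule attains_cyclic_blocks[OF n _ min M(1,2) cm, where s = s and x = x and y = x])
    show "2 = (3::nat) \<or> (2::nat) = 2 \<and> \<not> int n dvd x 0 - x 1" using n by (simp add: x_def)
    have two: "{..<2} = {0, 1::nat}" by auto
    show "(\<Sum>i<2. s i + x i + x i) = (\<Sum>i\<in>M. v i)"
      using v_M[of M] by (simp add: two s_def x_def M_def)
    show "\<exists>M'. M' \<noteq> {} \<and> M' \<subset> M \<and> (\<Sum>i\<in>Q. s i + x i + x i) = (\<Sum>i\<in>M'. v i)"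
      if "Q \<subset> {..<2}" "Q \<noteq> {}" for Q
    proof (rule proper)
      have "Q = {0} \<or> Q = {1}" using that unfolding two by auto
      then show "(\<Sum>i\<in>Q. s i + x i + x i) = 1 \<or> (\<Sum>i\<in>Q. s i + x i + x i) = 2"
        by (auto simp: s_def x_def)
    qed
    show "\<exists>M'. M' \<noteq> {} \<and> M' \<subset> M \<and>
          (\<Sum>i<2. if i \<in> D then x i + s (Suc i mod 2) else x i) = (\<Sum>i\<in>M'. v i)" for D
      by (rule proper) (simp add: two s_def x_def)
  qed
  moreover have "card I - card M + 2 * n = k + t + 2 * n" by (simp add: I_def M_def)
  ultimately show ?thesis by simp
qed

section \<open>From families to sequences over groups\<close>

lemma (in comm_monoid) seq_sum_superset:
  assumes "finite A" "set_mset S \<subseteq> A" "A \<subseteq> carrier G"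
  shows "seq_sum G S = (\<Otimes>g\<in>A. g [^] count S g)"
  unfolding seq_sum_def using assms
  by (intro finprod_mono_neutral_cong_left) (auto simp: not_in_iff)

lemma (in comm_monoid) seq_sum_add_mset:
  assumes x: "x \<in> carrier G" and S: "set_mset S \<subseteq> carrier G"
  shows "seq_sum G (add_mset x S) = x \<otimes> seq_sum G S"
proof -
  let ?A = "insert x (set_mset S)"
  have A: "finite ?A" "?A \<subseteq> carrier G" using assms by auto
  have "seq_sum G (add_mset x S) = (\<Otimes>g\<in>?A. g [^] count (add_mset x S) g)"
    using A by (intro seq_sum_superset) auto
  also have "\<dots> = (\<Otimes>g\<in>?A. (if x = g then g else \<one>) \<otimes> g [^] count S g)"
  proof (rule finprod_cong'[OF refl])
    show "(\<lambda>g. (if x = g then g else \<one>) \<otimes> g [^] count S g) \<in> ?A \<rightarrow> carrier G" using A by auto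
    fix g assume "g \<in> ?A"
    then have "g \<in> carrier G" using A(2) by blast
    then show "g [^] count (add_mset x S) g = (if x = g then g else \<one>) \<otimes> g [^] count S g"
      by (auto simp: m_comm)
  qed
  also have "\<dots> = (\<Otimes>g\<in>?A. if x = g then g else \<one>) \<otimes> (\<Otimes>g\<in>?A. g [^] count S g)"
    using A by (intro finprod_multf) auto
  also have "(\<Otimes>g\<in>?A. if x = g then g else \<one>) = x"
    using A finprod_singleton[of x ?A "\<lambda>g. g"] by (auto simp: Pi_iff)
  also have "(\<Otimes>g\<in>?A. g [^] count S g) = seq_sum G S"
    using A by (intro seq_sum_superset[symmetric]) auto
  finally show ?thesis .
qed

lemma (in comm_monoid) seq_sum_image_mset:
  assumes "finite J" "h ` J \<subseteq> carrier G"
  shows "seq_sum G (image_mset h (mset_set J)) = (\<Otimes>j\<in>J. h j)"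
  using assms
proof (induction J rule: finite_induct)
  case empty
  then show ?case by (simp add: seq_sum_def)
next
  case (insert j J)
  then show ?case by (simp add: seq_sum_add_mset finprod_insert image_subset_iff Pi_iff)
qed

text \<open>
  Subsequences are multisets, but those of an indexed family can be named by sets of indices.
\<close>

lemma subset_image_mset_set:
  assumes "finite I" "T \<subseteq># image_mset h (mset_set I)"
  obtains J where "J \<subseteq> I" "T = image_mset h (mset_set J)"
proof -
  obtain R where "image_mset h (mset_set I) = T + R"
    using assms(2) by (metis subset_mset.add_diff_inverse)
  then obtain B C where B: "mset_set I = B + C" "T = image_mset h B"
    by (auto dest!: image_mset_eq_plusD)
  have "count B i \<le> 1" for i
    using arg_cong[OF B(1), of "\<lambda>Z. count Z i"] by (simp add: count_mset_set' split: if_splits)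
  then have "count B i = count (mset_set (set_mset B)) i" for i
    by (cases "i \<in># B") (auto simp: count_mset_set' not_in_iff le_antisym Suc_leI)
  then have "B = mset_set (set_mset B)" by (rule multiset_eqI)
  moreover have "set_mset B \<subseteq> I"
    using arg_cong[OF B(1), of set_mset] assms(1) by auto
  ultimately show thesis using that[of "set_mset B"] B(2) by simp
qed

text \<open>
  A finite group presented as $\mathbb{Z}^r$ modulo $n$ by a coordinate map \<open>\<phi>\<close>. Both
  \<^const>\<open>cyclic_power\<close> and \<^const>\<open>integer_mod_group\<close> (with \<open>r = 1\<close>) are of this kind.
\<close>

locale residue_coordinates = comm_group G for G (structure) +
  fixes n r :: nat and \<phi> :: "(nat \<Rightarrow> int) \<Rightarrow> 'a"
  assumes finite_carrier: "finite (carrier G)"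
    and range_coord: "range \<phi> = carrier G"
    and coord_add: "\<And>u v. \<phi> (\<lambda>c. u c + v c) = \<phi> u \<otimes> \<phi> v"
    and coord_eq_iff: "\<And>u v. \<phi> u = \<phi> v \<longleftrightarrow> residues_upto n r u = residues_upto n r v"
begin

lemma coord_closed [simp]: "\<phi> v \<in> carrier G"
  using range_coord by blast

lemma coord_zero: "\<phi> (\<lambda>_. 0) = \<one>"
proof -
  have "\<phi> (\<lambda>_. 0) \<otimes> \<phi> (\<lambda>_. 0) = \<phi> (\<lambda>_. 0)" by (simp flip: coord_add)
  then show ?thesis by (metis coord_closed l_cancel_one')
qed

lemma coord_sum:
  assumes "finite J"
  shows "\<phi> (\<lambda>c. \<Sum>i\<in>J. f i c) = (\<Otimes>i\<in>J. \<phi> (f i))"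
  using assms by (induction J rule: finite_induct) (simp_all add: coord_zero coord_add)

lemma seq_sum_coord_eq_one_iff:
  assumes "finite J"
  shows "seq_sum G (image_mset (\<lambda>i. \<phi> (f i)) (mset_set J)) = \<one> \<longleftrightarrow> zero_sum_on n r f J"
  using assms
  by (subst seq_sum_image_mset)
     (auto simp: coord_eq_iff residues_upto_eq_iff cong_0_iff zero_sum_on_def
       simp flip: coord_sum coord_zero)

lemma min_zero_sum_iff_family:
  assumes I: "finite I"
  shows "min_zero_sum G (image_mset (\<lambda>i. \<phi> (f i)) (mset_set I)) \<longleftrightarrow> min_zero_sum_family n r f I"
    (is "min_zero_sum G (?S I) \<longleftrightarrow> _")
proof
  assume min: "min_zero_sum G (?S I)"
  show "min_zero_sum_family n r f I"
    unfolding min_zero_sum_family_def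
  proof (intro conjI allI impI)
    show "I \<noteq> {}" using min by (auto simp: min_zero_sum_def)
    show "zero_sum_on n r f I" using min I by (simp add: min_zero_sum_def seq_sum_coord_eq_one_iff)
    fix J assume J: "J \<subseteq> I" "zero_sum_on n r f J"
    have finJ: "finite J" using J(1) I finite_subset by blast
    show "J = {} \<or> J = I"
    proof (rule ccontr)
      assume "\<not> (J = {} \<or> J = I)"
      then have "J \<noteq> {}" "J \<subset> I" using J(1) by auto
      then have "?S J \<noteq> {#}" "?S J \<subset># ?S I"
        using finJ I psubset_card_mono[of I J]
        by (auto simp: mset_set_empty_iff subset_mset.less_le image_mset_subseteq_mono dest: arg_cong[of _ _ size])
      then show False using min J(2) finJ by (auto simp: min_zero_sum_def seq_sum_coord_eq_one_iff)
    qed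
  qed (rule I)
next
  assume fam: "min_zero_sum_family n r f I"
  show "min_zero_sum G (?S I)"
    unfolding min_zero_sum_def
  proof (intro conjI allI impI)
    show "?S I \<noteq> {#}" using fam by (auto simp: min_zero_sum_family_def mset_set_empty_iff)
    show "seq_sum G (?S I) = \<one>" using fam I by (simp add: seq_sum_coord_eq_one_iff min_zero_sum_family_def)
    fix T assume T: "T \<subset># ?S I" "T \<noteq> {#}"
    then obtain J where J: "J \<subseteq> I" "T = ?S J"
      using subset_image_mset_set[OF I, of T] by (metis subset_mset.less_imp_le)
    then have "J \<noteq> {}" "J \<noteq> I" "finite J" using T I finite_subset by auto
    then show "seq_sum G T \<noteq> \<one>"
      using fam J by (auto simp: seq_sum_coord_eq_one_iff min_zero_sum_family_def)
  qed (use I in auto)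
qed

lemma exists_coordinates:
  assumes "set_mset S \<subseteq> carrier G"
  obtains f :: "nat \<Rightarrow> nat \<Rightarrow> int"
  where "S = image_mset (\<lambda>i. \<phi> (f i)) (mset_set {..<size S})"
proof -
  obtain xs where xs: "S = mset xs" by (metis ex_mset)
  define f where "f i = inv_into UNIV \<phi> (xs ! i)" for i
  have "\<phi> (f i) = xs ! i" if "i < size S" for i
  proof -
    have "xs ! i \<in> range \<phi>" unfolding range_coord using that assms by (auto simp: xs)
    then show ?thesis unfolding f_def by (rule f_inv_into_f)
  qed
  then have "image_mset (\<lambda>i. \<phi> (f i)) (mset_set {..<size S}) = image_mset (\<lambda>i. xs ! i) (mset_set {..<size S})"
    by (intro image_mset_cong) auto
  also have "\<dots> = S"
    unfolding xs by (simp add: atLeast0LessThan[symmetric] flip: mset_map mset_upt) (simp add: map_nth)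
  finally show thesis using that[of f] by simp
qed

lemma cumulated_mult_add_card:
  assumes "set_mset S \<subseteq> carrier G"
  shows "cumulated_mult G S + card (set_mset S) = size S"
proof -
  have "cumulated_mult G S = (\<Sum>g\<in>set_mset S. count S g - 1)"
    unfolding cumulated_mult_def using assms finite_carrier
    by (intro sum.mono_neutral_right) (auto simp: not_in_iff)
  also have "\<dots> + card (set_mset S) = (\<Sum>g\<in>set_mset S. (count S g - 1) + 1)"
    by (simp only: sum.distrib card_eq_sum)
  also have "\<dots> = (\<Sum>g\<in>set_mset S. count S g)"
    by (intro sum.cong refl) (simp add: count_greater_zero_iff Suc_leI)
  finally show ?thesis by (simp add: size_multiset_overloaded_eq)
qed

lemma strong_davenport_sizes:
  "{size S | S. min_zero_sum G S \<and> cumulated_mult G S \<le> k} = {l. attains n r k l}"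
proof (intro equalityI subsetI; elim CollectE exE conjE)
  have card_image: "card (set_mset (image_mset (\<lambda>i. \<phi> (f i)) (mset_set {..<l}))) =
      card ((\<lambda>i. residues_upto n r (f i)) ` {..<l})" for f :: "nat \<Rightarrow> nat \<Rightarrow> int" and l
  proof -
    define \<psi> where "\<psi> g = residues_upto n r (inv_into UNIV \<phi> g)" for g
    have \<psi>: "\<psi> (\<phi> v) = residues_upto n r v" for v
      unfolding \<psi>_def coord_eq_iff[symmetric] using f_inv_into_f[of "\<phi> v" \<phi> UNIV] by simp
    have "inj_on \<psi> (\<phi> ` f ` {..<l})" by (auto simp: inj_on_def \<psi> coord_eq_iff)
    from card_image[OF this] show ?thesis by (simp add: image_image \<psi>)
  qed
  {
    fix l S assume S: "l = size S" "min_zero_sum G S" "cumulated_mult G S \<le> k"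
    then have sub: "set_mset S \<subseteq> carrier G" by (simp add: min_zero_sum_def)
    then obtain f :: "nat \<Rightarrow> nat \<Rightarrow> int" where f: "S = image_mset (\<lambda>i. \<phi> (f i)) (mset_set {..<l})"
      using exists_coordinates[of S] S(1) by blast
    have "min_zero_sum_family n r f {..<l}"
      using S(2) min_zero_sum_iff_family[of "{..<l}" f] f by simp
    moreover have "l \<le> k + card ((\<lambda>i. residues_upto n r (f i)) ` {..<l})"
      using cumulated_mult_add_card[OF sub] S(1,3) card_image[of f l, folded f] by simp
    ultimately show "l \<in> {l. attains n r k l}" by (auto simp: attains_def)
  next
    fix l assume "attains n r k l"
    then obtain f :: "nat \<Rightarrow> nat \<Rightarrow> int" where f: "min_zero_sum_family n r f {..<l}"
        "l \<le> k + card ((\<lambda>i. residues_upto n r (f i)) ` {..<l})"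
      by (auto simp: attains_def)
    define S where "S = image_mset (\<lambda>i. \<phi> (f i)) (mset_set {..<l})"
    have "min_zero_sum G S" using f(1) by (simp add: S_def min_zero_sum_iff_family)
    moreover have "size S = l" by (simp add: S_def)
    moreover have "set_mset S \<subseteq> carrier G" by (auto simp: S_def)
    ultimately show "l \<in> {size S | S. min_zero_sum G S \<and> cumulated_mult G S \<le> k}"
      using cumulated_mult_add_card[of S] card_image[of f l, folded S_def] f(2)
      by (intro CollectI exI[of _ S]) auto
  }
qed

lemma strong_davenport_eq_Max: "strong_davenport k G = Max {l. attains n r k l}"
  unfolding strong_davenport_def strong_davenport_sizes ..

end

lemma residue_coordinates_integer_mod_group:
  assumes "0 < n"
  shows "residue_coordinates (integer_mod_group n) n 1 (\<lambda>v. v 0 mod int n)"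
proof -
  interpret comm_group "integer_mod_group n" by simp
  show ?thesis
  proof unfold_locales
    show "range (\<lambda>v. v 0 mod int n) = carrier (integer_mod_group n)"
    proof (intro equalityI subsetI)
      fix z assume "z \<in> carrier (integer_mod_group n)"
      then have "z = (\<lambda>_. z) 0 mod int n" using assms by (simp add: carrier_integer_mod_group)
      then show "z \<in> range (\<lambda>v. v 0 mod int n)" by (intro range_eqI[of _ _ "\<lambda>_. z"]) simp
    qed (use assms in \<open>auto simp: carrier_integer_mod_group\<close>)
  qed (use assms in \<open>auto simp: carrier_integer_mod_group mod_simps residues_upto_eq_iff cong_def\<close>)
qed

lemma residue_coordinates_cyclic_power:
  assumes "0 < n"
  shows "residue_coordinates (cyclic_power n r) n r (residues_upto n r)"
proof -
  interpret group "cyclic_power n r"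
    unfolding cyclic_power_def by (rule product_group) simp
  have carrier: "carrier (cyclic_power n r) = (\<Pi>\<^sub>E c\<in>{..<r}. {0..<int n})"
    using assms by (simp add: cyclic_power_def carrier_integer_mod_group)
  interpret comm_group "cyclic_power n r"
    by (rule group_comm_groupI) (simp add: cyclic_power_def add.commute)
  show ?thesis
  proof unfold_locales
    show "finite (carrier (cyclic_power n r))" unfolding carrier by (intro finite_PiE) auto
    show "range (residues_upto n r) = carrier (cyclic_power n r)"
    proof (intro equalityI subsetI)
      fix z assume "z \<in> carrier (cyclic_power n r)"
      then have "z = residues_upto n r z"
        unfolding carrier by (auto simp: residues_upto_def fun_eq_iff restrict_def PiE_iff extensional_def)
      then show "z \<in> range (residues_upto n r)" by (intro range_eqI[of _ _ z])
    qed (use assms in \<open>auto simp: carrier residues_upto_def\<close>)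
    show "residues_upto n r (\<lambda>c. u c + v c) = residues_upto n r u \<otimes>\<^bsub>cyclic_power n r\<^esub> residues_upto n r v" for u v
      by (auto simp: residues_upto_def cyclic_power_def fun_eq_iff mod_simps)
  qed auto
qed

context residue_coordinates
begin

lemma davenport_sizes: "{size S | S. min_zero_sum G S} = {l. \<exists>k. attains n r k l}"
  using strong_davenport_sizes by (auto simp: set_eq_iff)

lemma finite_attained:
  assumes "0 < n"
  shows "finite {l. \<exists>k. attains n r k l}" "finite {l. attains n r k l}"
  using attains_length_le[OF assms] by (auto intro: finite_subset[of _ "{..n ^ r}"])

lemma attains_strong_davenport:
  assumes "0 < n"
  shows "attains n r k (strong_davenport k G)"
proof -
  have "strong_davenport k G \<in> {l. attains n r k l}"
    unfolding strong_davenport_eq_Max using finite_attained(2)[OF assms] attains_one[of n r k] by (intro Max_in) blast+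
  then show ?thesis by simp
qed

lemma le_strong_davenport: "0 < n \<Longrightarrow> attains n r k l \<Longrightarrow> l \<le> strong_davenport k G"
  unfolding strong_davenport_eq_Max using finite_attained(2) by (intro Max_ge) auto

lemma strong_davenport_le_davenport: "0 < n \<Longrightarrow> strong_davenport k G \<le> davenport G"
  unfolding davenport_def davenport_sizes
  using finite_attained(1) attains_strong_davenport by (intro Max_ge) auto

lemma davenport_eqI:
  assumes "0 < n" "attains n r k d" "\<And>k l. attains n r k l \<Longrightarrow> l \<le> d"
  shows "davenport G = d"
  unfolding davenport_def davenport_sizes
  using finite_attained(1)[OF assms(1)] assms(2,3) by (intro Max_eqI) auto

end

section \<open>The Davenport constant for prime powers\<close>

text \<open>
  A product of \<open>d\<close> affine functions of the indicator vector of \<open>J\<close> is a polynomial of degree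
  at most \<open>d\<close>, and a multilinear monomial in fewer than \<open>card I\<close> variables cancels in the
  alternating sum over the cube. The induction peels off one factor: its constant term leaves the
  sum for \<open>d\<close> factors, and its term at \<open>i\<close> leaves a sum over the sets that contain \<open>i\<close>, that is, over the
  smaller cube of subsets of \<open>I - {i}\<close> with shifted constants.
\<close>

lemma alternating_sum_affine_product:
  fixes a :: "nat \<Rightarrow> 'i \<Rightarrow> int" and b :: "nat \<Rightarrow> int"
  assumes "finite I" "d < card I"
  shows "(\<Sum>J\<in>Pow I. (- 1) ^ card J * (\<Prod>j<d. b j + (\<Sum>i\<in>J. a j i))) = 0"
  using assms
proof (induction d arbitrary: I b)
  case 0
  then obtain i I' where I: "I = insert i I'" "i \<notin> I'" "finite I'"
    by (metis card_gt_0_iff ex_in_conv finite_Diff insert_Diff Diff_iff singletonI)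
  have disj: "Pow I' \<inter> insert i ` Pow I' = {}" using I(2) by auto
  have inj: "inj_on (insert i) (Pow I')" using I(2) by (auto simp: inj_on_def)
  have card: "card (insert i J) = Suc (card J)" if "J \<subseteq> I'" for J
    using that I finite_subset[OF that] by (auto simp: card_insert_if)
  show ?case
    unfolding I(1) Pow_insert using I(3) disj inj card
    by (simp add: sum.union_disjoint sum.reindex sum_negf)
next
  case (Suc d)
  let ?P = "\<lambda>J. \<Prod>j<d. b j + (\<Sum>i\<in>J. a j i)"
  have part: "(\<Sum>J | J \<subseteq> I \<and> i \<in> J. (- 1) ^ card J * ?P J) = 0" if i: "i \<in> I" for i
  proof -
    define I' where "I' = I - {i}"
    have I: "I = insert i I'" "i \<notin> I'" "finite I'" using i Suc.prems by (auto simp: I'_def)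
    have eq: "{J. J \<subseteq> I \<and> i \<in> J} = insert i ` Pow I'"
    proof (intro equalityI subsetI)
      fix J assume "J \<in> {J. J \<subseteq> I \<and> i \<in> J}"
      then have "J = insert i (J - {i})" "J - {i} \<in> Pow I'" by (auto simp: I'_def)
      then show "J \<in> insert i ` Pow I'" by blast
    qed (use I in auto)
    have inj: "inj_on (insert i) (Pow I')" using I(2) by (auto simp: inj_on_def)
    have fin: "finite J" "i \<notin> J" if "J \<in> Pow I'" for J
      using that I finite_subset[of J I'] by auto
    have "(\<Sum>J | J \<subseteq> I \<and> i \<in> J. (- 1) ^ card J * ?P J)
            = (\<Sum>J\<in>Pow I'. - ((- 1) ^ card J * (\<Prod>j<d. (b j + a j i) + (\<Sum>i\<in>J. a j i))))"
      unfolding eq using inj fin by (simp add: sum.reindex add.assoc)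
    also have "\<dots> = 0"
      using Suc.IH[of I' "\<lambda>j. b j + a j i"] Suc.prems I by (simp add: sum_negf)
    finally show ?thesis .
  qed
  have "(\<Sum>J\<in>Pow I. (- 1) ^ card J * (\<Prod>j<Suc d. b j + (\<Sum>i\<in>J. a j i)))
          = b d * (\<Sum>J\<in>Pow I. (- 1) ^ card J * ?P J)
            + (\<Sum>J\<in>Pow I. \<Sum>i\<in>J. a d i * ((- 1) ^ card J * ?P J))"
    by (simp add: algebra_simps sum.distrib sum_distrib_left sum_distrib_right)
  also have "(\<Sum>J\<in>Pow I. (- 1) ^ card J * ?P J) = 0"
    using Suc.prems by (intro Suc.IH) auto
  also have "(\<Sum>J\<in>Pow I. \<Sum>i\<in>J. a d i * ((- 1) ^ card J * ?P J))
               = (\<Sum>J\<in>Pow I. \<Sum>i | i \<in> I \<and> i \<in> J. a d i * ((- 1) ^ card J * ?P J))"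
    by (intro sum.cong refl) (auto intro: sum.cong)
  also have "\<dots> = (\<Sum>i\<in>I. \<Sum>J | J \<in> Pow I \<and> i \<in> J. a d i * ((- 1) ^ card J * ?P J))"
    using Suc.prems by (intro sum.swap_restrict) auto
  also have "\<dots> = 0"
    using part by (simp flip: sum_distrib_left)
  finally show ?case by simp
qed

text \<open>
  In $n \binom{s+n}{n} = (s+n) \binom{s+n-1}{n-1}$ the left-hand side is divisible by $p^e$ but $s + n$
  is not, so \<open>p\<close> divides the other factor.
\<close>

lemma prime_dvd_binomial_shifted:
  assumes p: "Factorial_Ring.prime (p::nat)" and n: "n = p ^ e" and ndvd: "\<not> n dvd s"
  shows "p dvd (s + n - 1) choose (n - 1)"
proof (rule ccontr)
  assume np: "\<not> p dvd (s + n - 1) choose (n - 1)"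
  have pos: "0 < n" using p n by (simp add: prime_gt_0_nat)
  have "n * ((s + n) choose n) = (s + n) * ((s + n - 1) choose (n - 1))"
    using times_binomial_minus1_eq[of n "s + n"] pos by simp
  then have "p ^ e dvd (s + n) * ((s + n - 1) choose (n - 1))"
    by (metis dvd_triv_left n)
  moreover have "coprime (p ^ e) ((s + n - 1) choose (n - 1))"
    using np p by (simp add: prime_imp_coprime)
  ultimately have "n dvd s + n" using n coprime_dvd_mult_left_iff by blast
  then show False using ndvd by simp
qed

text \<open>
  This exhibits the binomial coefficient, up to a constant factor, as a product of affine functions of \<open>s\<close>.
\<close>

lemma prod_shifted_eq_fact_binomial:
  "(\<Prod>i<m. (1 + int i) + int s) = fact m * int ((s + m) choose m)"
proof (induction m)
  case (Suc m)
  have "Suc m * ((s + Suc m) choose Suc m) = (s + Suc m) * ((s + m) choose m)"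
    using Suc_times_binomial[of m "s + m"] by simp
  then have "int (Suc m * ((s + Suc m) choose Suc m)) = int ((s + Suc m) * ((s + m) choose m))"
    by (rule arg_cong)
  then have "int (Suc m) * int ((s + Suc m) choose Suc m) = (1 + int m + int s) * int ((s + m) choose m)"
    by (simp only: of_nat_mult) (simp add: add_ac)
  then have "fact m * int ((s + m) choose m) * (1 + int m + int s)
               = fact (Suc m) * int ((s + Suc m) choose Suc m)"
    by (simp only: fact_Suc of_nat_mult mult_ac)
  with Suc show ?case by simp
qed simp

text \<open>
  Olson's theorem for $C_n^r$. Without such a subset, all terms of the alternating sum except that of
  the empty set, which is $1$, would be divisible by \<open>p\<close>, although the sum vanishes.
\<close>

theorem prime_power_zero_sum_subset:
  fixes g :: "'i \<Rightarrow> nat \<Rightarrow> nat"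
  assumes n: "primepow n" and I: "finite I" "r * (n - 1) < card I"
  shows "\<exists>J\<subseteq>I. J \<noteq> {} \<and> (\<forall>c<r. n dvd (\<Sum>i\<in>J. g i c))"
proof (rule ccontr)
  assume no: "\<not> ?thesis"
  obtain p e where p: "Factorial_Ring.prime p" "n = p ^ e"
    using n by (auto simp: primepow_def)
  have npos: "0 < n" using p by (simp add: prime_gt_0_nat)
  define s where "s J c = (\<Sum>i\<in>J. g i c)" for J c
  define F where "F J = (\<Prod>c<r. (s J c + n - 1) choose (n - 1))" for J
  \<comment> \<open>factor \<open>j\<close> is factor number \<open>j mod (n - 1)\<close> of the coordinate \<open>j div (n - 1)\<close>\<close>
  have prodF: "(\<Prod>j<r * (n - 1). (1 + int (j mod (n - 1))) + (\<Sum>i\<in>J. int (g i (j div (n - 1)))))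
                 = fact (n - 1) ^ r * int (F J)" for J
  proof -
    have "(\<Prod>j<r * (n - 1). (1 + int (j mod (n - 1))) + (\<Sum>i\<in>J. int (g i (j div (n - 1)))))
            = (\<Prod>c<r. \<Prod>j\<in>{c * (n - 1)..<c * (n - 1) + (n - 1)}.
                 (1 + int (j mod (n - 1))) + int (s J (j div (n - 1))))"
      by (simp add: s_def prod.nat_group)
    also have "\<dots> = (\<Prod>c<r. \<Prod>i<n - 1. (1 + int i) + int (s J c))"
    proof (rule prod.cong[OF refl])
      fix c
      have "(\<Prod>j\<in>{c * (n - 1)..<c * (n - 1) + (n - 1)}.
                 (1 + int (j mod (n - 1))) + int (s J (j div (n - 1))))
             = (\<Prod>i<n - 1. (1 + int ((i + c * (n - 1)) mod (n - 1))) + int (s J ((i + c * (n - 1)) div (n - 1))))"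
        by (rule prod.reindex_bij_witness[where i = "\<lambda>i. i + c * (n - 1)" and j = "\<lambda>j. j - c * (n - 1)"]) auto
      also have "\<dots> = (\<Prod>i<n - 1. (1 + int i) + int (s J c))"
        by (intro prod.cong refl) auto
      finally show "(\<Prod>j\<in>{c * (n - 1)..<c * (n - 1) + (n - 1)}.
                 (1 + int (j mod (n - 1))) + int (s J (j div (n - 1))))
             = (\<Prod>i<n - 1. (1 + int i) + int (s J c))" .
    qed
    also have "\<dots> = fact (n - 1) ^ r * int (F J)"
      using npos by (simp add: prod_shifted_eq_fact_binomial F_def prod.distrib)
    finally show ?thesis .
  qed
  have "fact (n - 1) ^ r * (\<Sum>J\<in>Pow I. (- 1) ^ card J * int (F J)) = (0::int)"
    using alternating_sum_affine_product[OF I,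
        of "\<lambda>j. 1 + int (j mod (n - 1))" "\<lambda>j i. int (g i (j div (n - 1)))"]
    unfolding prodF by (simp add: sum_distrib_left algebra_simps)
  then have "(\<Sum>J\<in>Pow I. (- 1) ^ card J * int (F J)) = 0" by simp
  then have "1 + (\<Sum>J\<in>Pow I - {{}}. (- 1) ^ card J * int (F J)) = 0"
    using I(1) by (subst (asm) sum.remove[of _ "{}"]) (auto simp: F_def s_def)
  moreover have "int p dvd (\<Sum>J\<in>Pow I - {{}}. (- 1) ^ card J * int (F J))"
  proof (intro dvd_sum dvd_mult)
    fix J assume "J \<in> Pow I - {{}}"
    with no obtain c where c: "c < r" "\<not> n dvd s J c" by (auto simp: s_def)
    then have "p dvd (s J c + n - 1) choose (n - 1)"
      using prime_dvd_binomial_shifted p by blast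
    then have "p dvd F J"
      unfolding F_def using c(1) by (meson dvd_prodI dvd_trans finite_lessThan lessThan_iff)
    then show "int p dvd int (F J)" by simp
  qed
  ultimately have "int p dvd 1" by (metis dvd_add_left_iff dvd_0_right)
  then show False using p by auto
qed

text \<open>
  All but the last term of a longer sequence would still contain a zero-sum subsequence.
\<close>

lemma attains_le_primepow:
  assumes n: "primepow n" and l: "attains n r k l"
  shows "l \<le> r * (n - 1) + 1"
proof (rule ccontr)
  assume "\<not> ?thesis"
  then have gt: "r * (n - 1) < card {..<l - 1}" by simp
  obtain f :: "nat \<Rightarrow> nat \<Rightarrow> int" where f: "min_zero_sum_family n r f {..<l}"
    using l by (auto simp: attains_def)
  have npos: "0 < n" using primepow_gt_Suc_0[OF n] by simp
  obtain J where J: "J \<subseteq> {..<l - 1}" "J \<noteq> {}" "\<forall>c<r. n dvd (\<Sum>i\<in>J. nat (f i c mod int n))"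
    using prime_power_zero_sum_subset[OF n _ gt, of "\<lambda>i c. nat (f i c mod int n)"] by auto
  have "zero_sum_on n r f J"
    unfolding zero_sum_on_def
  proof (intro allI impI)
    fix c assume "c < r"
    then have "int n dvd int (\<Sum>i\<in>J. nat (f i c mod int n))" using J(3) by (simp only: int_dvd_int_iff)
    moreover have "int (\<Sum>i\<in>J. nat (f i c mod int n)) = (\<Sum>i\<in>J. f i c mod int n)"
      using npos by simp
    ultimately show "int n dvd (\<Sum>i\<in>J. f i c)" by (simp add: mod_sum_eq dvd_eq_mod_eq_0)
  qed
  moreover have "J \<subseteq> {..<l}" using J(1) by auto
  ultimately have "J = {..<l}" using f J(2) unfolding min_zero_sum_family_def by blast
  then have "l - 1 \<in> J" using gt by simp
  then show False using J(1) by auto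
qed

section \<open>Triangular numbers and the explicit bounds\<close>

text \<open>
  The expression is the positive root of $q (q + 1) = 2 z$, so that \<open>T\<close> indexes the largest triangular
  number up to \<open>z\<close>.
\<close>

lemma floor_triangular_root:
  fixes z :: int
  assumes "0 \<le> z"
  defines "T \<equiv> \<lfloor>(- 1 + sqrt (1 + 8 * real_of_int z)) / 2\<rfloor>"
  shows "0 \<le> T" "T * (T + 1) \<le> 2 * z" "1 \<le> z \<Longrightarrow> 1 \<le> T"
proof -
  define q where "q = (- 1 + sqrt (1 + 8 * real_of_int z)) / 2"
  have "2 * q + 1 = sqrt (1 + 8 * real_of_int z)" by (simp add: q_def field_simps)
  then have sq: "(2 * q + 1) * (2 * q + 1) = 1 + 8 * real_of_int z"
    using assms(1) by simp
  have q0: "0 \<le> q" using assms(1) by (simp add: q_def)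
  have T: "T = \<lfloor>q\<rfloor>" by (simp add: T_def q_def)
  show T0: "0 \<le> T" using q0 by (simp add: T)
  have le: "real_of_int T \<le> q" by (simp add: T)
  have "real_of_int T * (real_of_int T + 1) \<le> q * (q + 1)"
    using T0 le q0 by (intro mult_mono) auto
  also have "\<dots> = 2 * real_of_int z" using sq by (simp add: algebra_simps)
  finally have "real_of_int (T * (T + 1)) \<le> real_of_int (2 * z)" by simp
  then show "T * (T + 1) \<le> 2 * z" by (simp only: of_int_le_iff)
  show "1 \<le> T" if "1 \<le> z"
  proof -
    have "sqrt 9 \<le> sqrt (1 + 8 * real_of_int z)" using that by (intro real_sqrt_le_mono) simp
    then have "1 \<le> q" by (simp add: q_def)
    then show ?thesis by (simp add: T le_floor_iff)
  qed
qed

text \<open>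
  The staircase is applied with \<open>K = k + r - 1\<close>, for which \<open>x = n - K\<close>. If \<open>x \<le> 0\<close> then
  even $1^n$ has small enough cumulated multiplicity.
\<close>

lemma attains_triangular_bound:
  fixes n r k :: nat
  assumes n: "3 \<le> n" and r: "4 \<le> r"
  defines "x \<equiv> int n - int k - int r + 1"
  defines "T \<equiv> \<lfloor>(- 1 + sqrt (1 + 8 * real_of_int (max x 0))) / 2\<rfloor>"
  shows "\<exists>l. attains n r k l \<and> int l \<ge> int (r * (n - 1) + 1) - max 0 (x - T)"
proof -
  have rn: "r * (n - 1) = (r - 1) * (n - 1) + (n - 1)" using r by (cases r) auto
  note T = floor_triangular_root[of "max x 0", folded T_def]
  show ?thesis
  proof (cases "1 \<le> x")
    case False
    have "attains n 1 n n" using attains_cyclic_staircase[of n n 0] n by simp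
    then have "attains n 1 (k + r - 1) n" using False r by (elim attains_mono) (simp add: x_def)
    from attains_from_cyclic[OF n r n this] show ?thesis
      using n unfolding rn by (intro exI conjI) auto
  next
    case True
    define K where "K = k + r - 1"
    have x: "x = int n - int K" using r by (simp add: x_def K_def)
    define t where "t = nat T"
    have t: "int t = T" using T(1) by (simp add: t_def)
    have "int (2 * K + t * (t + 1)) \<le> int (2 * n)" using T(2) True x t by (simp add: algebra_simps)
    then have le: "2 * K + t * (t + 1) \<le> 2 * n" by (simp only: of_nat_le_iff)
    have t1: "1 \<le> t" using T(3) True t by simp
    then have "attains n 1 K (K + t)" using n le by (intro attains_cyclic_staircase) auto
    moreover have "3 \<le> K + t" using r by (simp add: K_def)
    ultimately have "attains n r k (K + t + (r - 1) * (n - 1))"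
      using attains_from_cyclic[OF n r] by (simp add: K_def)
    then show ?thesis
      using n t x unfolding rn by (intro exI conjI) auto
  qed
qed

lemma attains_rank_three_triangular_bound:
  fixes n k :: nat
  assumes n: "3 \<le> n"
  defines "T \<equiv> \<lfloor>(- 1 + sqrt (1 + 8 * real_of_int (max (int n - 3 - int k) 0))) / 2\<rfloor>"
  shows "\<exists>l. attains n 3 k l \<and> int l \<ge> int (3 * (n - 1) + 1) - max 1 (int n - int k - 2 - T)"
proof (cases "k \<le> n - 3")
  case False
  have "attains n 3 (n - 3) (n - 3 + 0 + 2 * n)" using n by (intro attains_rank_three) auto
  then have "attains n 3 k (n - 3 + 0 + 2 * n)" using False by (elim attains_mono) simp
  then show ?thesis using n by (intro exI conjI) auto
next
  case True
  note T = floor_triangular_root[of "max (int n - 3 - int k) 0", folded T_def]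
  define t where "t = nat T"
  have t: "int t = T" using T(1) by (simp add: t_def)
  have "int (2 * k + t * (t + 1)) \<le> int (2 * (n - 3))" using T(2) True n t by (simp add: of_nat_diff algebra_simps)
  then have "2 * k + t * (t + 1) \<le> 2 * (n - 3)" by (simp only: of_nat_le_iff)
  moreover have "k = n - 3" if "t = 0" using T(3) that t True n by linarith
  ultimately have "attains n 3 k (k + t + 2 * n)" by (rule attains_rank_three[OF n])
  then show ?thesis using n t by (intro exI conjI) auto
qed

theorem theorem7p3:
  fixes n r k :: nat
  assumes "n \<ge> 3" and "r \<ge> 4"
  shows "strong_davenport k (cyclic_power n r)
           \<ge> strong_davenport (k + r - 1) (integer_mod_group n) + (r - 1) * (n - 1) \<and>
         int (strong_davenport k (cyclic_power n r))
           \<ge> int (Dstar (cyclic_power n r))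
              - max 0 (int n - int k - int r + 1
                       - \<lfloor>(- 1 + sqrt (1 + 8 * real_of_int (max (int n - int k - int r + 1) 0))) / 2\<rfloor>) \<and>
         (primepow n \<longrightarrow> davenport (cyclic_power n r) = Dstar (cyclic_power n r)) \<and>
         (davenport (cyclic_power n r) = Dstar (cyclic_power n r) \<longrightarrow> int r \<ge> int n - int k \<longrightarrow>
           strong_davenport k (cyclic_power n r) = Dstar (cyclic_power n r)) \<and>
         int (strong_davenport k (cyclic_power n 3))
           \<ge> int (Dstar (cyclic_power n 3))
              - max 1 (int n - int k - 2
                       - \<lfloor>(- 1 + sqrt (1 + 8 * real_of_int (max (int n - 3 - int k) 0))) / 2\<rfloor>)"
proof -
  have n0: "0 < n" using assms(1) by simp
  interpret C: residue_coordinates "integer_mod_group n" n 1 "\<lambda>v. v 0 mod int n"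
    by (rule residue_coordinates_integer_mod_group[OF n0])
  interpret P: residue_coordinates "cyclic_power n r" n r "residues_upto n r"
    by (rule residue_coordinates_cyclic_power[OF n0])
  interpret P3: residue_coordinates "cyclic_power n 3" n 3 "residues_upto n 3"
    by (rule residue_coordinates_cyclic_power[OF n0])
  have Dstar: "Dstar (cyclic_power n r) = r * (n - 1) + 1" for r
    using assms(1) by (intro Dstar_cyclic_power) simp
  let ?T = "\<lambda>z. \<lfloor>(- 1 + sqrt (1 + 8 * real_of_int (max z 0))) / 2\<rfloor>"
  let ?x = "\<lambda>k. int n - int k - int r + 1"

  \<comment> \<open>three terms are traded at once, so the extremal sequence over $C_n$ must have that many\<close>
  have "attains n 1 2 3" using attains_cyclic_staircase[of n 2 1] assms(1) by simp
  then have "attains n 1 (k + r - 1) 3" using assms(2) by (elim attains_mono) simp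
  then have "3 \<le> strong_davenport (k + r - 1) (integer_mod_group n)"
    by (rule C.le_strong_davenport[OF n0])
  then have one: "strong_davenport k (cyclic_power n r)
      \<ge> strong_davenport (k + r - 1) (integer_mod_group n) + (r - 1) * (n - 1)"
    using attains_from_cyclic[OF assms _ C.attains_strong_davenport[OF n0]]
    by (intro P.le_strong_davenport[OF n0])

  have two: "int (strong_davenport k (cyclic_power n r))
      \<ge> int (Dstar (cyclic_power n r)) - max 0 (?x k - ?T (?x k))" for k
  proof -
    obtain l where "attains n r k l" "int l \<ge> int (r * (n - 1) + 1) - max 0 (?x k - ?T (?x k))"
      using attains_triangular_bound[OF assms, of k] by blast
    then show ?thesis using P.le_strong_davenport[OF n0, of k l] unfolding Dstar by linarith
  qed

  have large: "Dstar (cyclic_power n r) \<le> strong_davenport k (cyclic_power n r)"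
    if "int n - int k \<le> int r" for k
  proof -
    have "?x k \<le> ?T (?x k)"
      using floor_triangular_root(1,3)[of "max (?x k) 0"] that by linarith
    then show ?thesis using two[of k] by linarith
  qed

  have olson: "davenport (cyclic_power n r) = Dstar (cyclic_power n r)" if "primepow n"
    unfolding Dstar
  proof (rule P.davenport_eqI[OF n0])
    \<comment> \<open>the lower bound is the one for \<open>k = n\<close>, where the correction term is zero\<close>
    let ?d = "strong_davenport n (cyclic_power n r)"
    show "l \<le> r * (n - 1) + 1" if "attains n r k l" for k l
      by (rule attains_le_primepow[OF \<open>primepow n\<close> that])
    from this[OF P.attains_strong_davenport[OF n0, of n]] have "?d = r * (n - 1) + 1"
      using large[of n] unfolding Dstar by simp
    then show "attains n r n (r * (n - 1) + 1)"
      using P.attains_strong_davenport[OF n0, of n] by simp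
  qed

  have four: "strong_davenport k (cyclic_power n r) = Dstar (cyclic_power n r)"
    if "davenport (cyclic_power n r) = Dstar (cyclic_power n r)" "int n - int k \<le> int r"
    using large[OF that(2)] P.strong_davenport_le_davenport[OF n0, of k] that(1) by simp

  have five: "int (strong_davenport k (cyclic_power n 3))
      \<ge> int (Dstar (cyclic_power n 3)) - max 1 (int n - int k - 2 - ?T (int n - 3 - int k))"
  proof -
    obtain l where "attains n 3 k l"
        "int l \<ge> int (3 * (n - 1) + 1) - max 1 (int n - int k - 2 - ?T (int n - 3 - int k))"
      using attains_rank_three_triangular_bound[OF assms(1), of k] by blast
    then show ?thesis using P3.le_strong_davenport[OF n0, of k l] unfolding Dstar by linarith
  qed
  from one two[of k] olson four five show ?thesis by blast
qed

end
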